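(* Let $n\ge 1$ be an integer and let $\lambda$ be a partition. Then $$V_{-n}\,\mathbf s_\lambda=\sum_{\mu:\ \mu\backslash\lambda\in B(n)} d^{(-n)}_{\lambda\mu}\,\mathbf s_\mu,\qquad V_{n}\,\mathbf s_\lambda=\sum_{\mu:\ \lambda\backslash\mu\in B(n)} d^{(-n)}_{\mu\lambda}\,\mathbf s_\mu,$$ where, for partitions $\lambda,\mu$, $$d^{(-n)}_{\lambda\mu}=\sum_{i\ge 1}\ \sum_{\nu}(-1)^{\mathrm{ht}(\lambda\backslash\nu)+\mathrm{ht}(\mu\backslash\nu)}+\frac12\sum_{i=1}^{n-1}\ \sum_{\nu'}(-1)^{\mathrm{ht}(\nu'\backslash\lambda)+\mathrm{ht}(\mu\backslash\nu')}.$$ Here, for each $i$, the sum over $\nu$ runs over the partitions $\nu$ with $\lambda\backslash\nu\in B(i)$, $\mu\backslash\nu\in B(n+i)$ and $\lambda\backslash\nu\subset\mu\backslash\nu$, and the sum over $\nu'$ runs over the partitions $\nu'$ with $\nu'\backslash\lambda\in B(i)$ and $\mu\backslash\nu'\in B(n-i)$.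
   Context: Variables $t=(t_1,t_2,\dots)$. The elementary Schur polynomials $\mathbf s_k(t)$ are defined by $e^{\sum_{i\ge1}t_iz^i}=\sum_{k\ge0}\mathbf s_k(t)z^k$, $\mathbf s_k=0$ for $k<0$. For a partition $\lambda$ with at most $m$ rows, $\mathbf s_\lambda(t)=\det(\mathbf s_{\lambda_i-i+j}(t))_{1\le i,j\le m}$; i.e. $\mathbf s_\lambda(t)$ is the Schur function of $\lambda$ written in power sums, with $kt_k=\sum_i x_i^k$. For $k\in\mathbb Z$ the Virasoro operator is $$V_k=\frac12\sum_{i+j=k}\frac{\partial^2}{\partial t_i\partial t_j}+\sum_{-i+j=k}it_i\frac{\partial}{\partial t_j}+\frac12\sum_{-i-j=k}(it_i)(jt_j),$$ all sums being over integers $i,j\ge1$. For $i\ge1$, $B(i)$ is the set of border strips with $i$ boxes: a border strip is a (nonempty) connected skew shape $\alpha\backslash\beta$ (with $\beta\subset\alpha$ partitions) containing no $2\times2$ square. Its height is $\mathrm{ht}(h)=\#\{\text{rows of }h\}-1$. Writing $\alpha\backslash\beta\in B(i)$ includes the requirement $\beta\subset\alpha$. *)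

theory Defs
  imports
    "HOL-Library.Poly_Mapping"
    "HOL-Computational_Algebra.Formal_Power_Series"
    "Jordan_Normal_Form.Determinant"
begin

section \<open>Polynomials in the variables $t_1, t_2, \dots$\<close>

text \<open>
  A monomial is a finitely supported exponent function, a polynomial a finitely supported
  function from monomials to coefficients (with the convolution product of
  \<^theory>\<open>HOL-Library.Poly_Mapping\<close>). The variable with index 0 exists in this ring,
  but is never used.
\<close>

type_synonym 'a tpoly = "(nat \<Rightarrow>\<^sub>0 nat) \<Rightarrow>\<^sub>0 'a"

definition Const :: "'a::zero \<Rightarrow> 'a tpoly" where
  "Const c = Poly_Mapping.single 0 c"

definition tvar :: "nat \<Rightarrow> 'a::zero_neq_one tpoly" where
  "tvar i = Poly_Mapping.single (Poly_Mapping.single i 1) 1"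

text \<open>
  Formal partial derivative. The subtraction of exponents truncates only if the exponent of
  the \<open>i\<close>-th variable is 0, and then the coefficient vanishes.
\<close>

definition tderiv :: "nat \<Rightarrow> 'a::semiring_1 tpoly \<Rightarrow> 'a tpoly" where
  "tderiv i p = (\<Sum>m\<in>Poly_Mapping.keys p.
     Poly_Mapping.single (m - Poly_Mapping.single i 1)
       (of_nat (Poly_Mapping.lookup m i) * Poly_Mapping.lookup p m))"

lemma finite_tderiv_support: "finite {j. tderiv j p \<noteq> 0}"
proof (rule finite_subset)
  show "{j. tderiv j p \<noteq> 0} \<subseteq> (\<Union>m\<in>Poly_Mapping.keys p. Poly_Mapping.keys m)"
    (is "_ \<subseteq> ?U")
  proof
    fix j assume "j \<in> {j. tderiv j p \<noteq> 0}"
    then have "tderiv j p \<noteq> 0" by simp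
    then obtain m where m: "m \<in> Poly_Mapping.keys p" "Poly_Mapping.lookup m j \<noteq> 0"
      unfolding tderiv_def by (metis (no_types, lifting) mult_zero_left of_nat_0 single_zero sum.neutral)
    then show "j \<in> ?U" by (auto simp: in_keys_iff)
  qed
qed simp


section \<open>Partitions and border strips\<close>

text \<open>Parts are indexed from 0: \<open>lam r\<close> is the length of the \<open>(r+1)\<close>-st row.\<close>

definition is_partition :: "(nat \<Rightarrow> nat) \<Rightarrow> bool" where
  "is_partition lam \<longleftrightarrow> antimono lam \<and> finite {r. lam r \<noteq> 0}"

definition nrows :: "(nat \<Rightarrow> nat) \<Rightarrow> nat" where
  "nrows lam = card {r. lam r \<noteq> 0}"

definition diagram :: "(nat \<Rightarrow> nat) \<Rightarrow> (nat \<times> nat) set" where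
  "diagram lam = {(r, c). c < lam r}"

definition skew :: "(nat \<Rightarrow> nat) \<Rightarrow> (nat \<Rightarrow> nat) \<Rightarrow> (nat \<times> nat) set" where
  "skew \<alpha> \<beta> = diagram \<alpha> - diagram \<beta>"

definition adjacent :: "nat \<times> nat \<Rightarrow> nat \<times> nat \<Rightarrow> bool" where
  "adjacent x y \<longleftrightarrow>
     fst x = fst y \<and> (snd x = Suc (snd y) \<or> snd y = Suc (snd x)) \<or>
     snd x = snd y \<and> (fst x = Suc (fst y) \<or> fst y = Suc (fst x))"

definition connected_boxes :: "(nat \<times> nat) set \<Rightarrow> bool" where
  "connected_boxes S \<longleftrightarrow>
     (\<forall>x\<in>S. \<forall>y\<in>S. (x, y) \<in> {(u, v). u \<in> S \<and> v \<in> S \<and> adjacent u v}\<^sup>*)"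

text \<open>\<open>border_strip i \<alpha> \<beta>\<close> expresses that $\alpha\backslash\beta \in B(i)$ (this includes
  $\beta \subset \alpha$).\<close>

definition border_strip :: "nat \<Rightarrow> (nat \<Rightarrow> nat) \<Rightarrow> (nat \<Rightarrow> nat) \<Rightarrow> bool" where
  "border_strip i \<alpha> \<beta> \<longleftrightarrow>
     is_partition \<alpha> \<and> is_partition \<beta> \<and> diagram \<beta> \<subseteq> diagram \<alpha> \<and>
     skew \<alpha> \<beta> \<noteq> {} \<and> connected_boxes (skew \<alpha> \<beta>) \<and>
     \<not> (\<exists>r c. {(r, c), (r, Suc c), (Suc r, c), (Suc r, Suc c)} \<subseteq> skew \<alpha> \<beta>) \<and>
     card (skew \<alpha> \<beta>) = i"

definition ht :: "(nat \<times> nat) set \<Rightarrow> nat" where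
  "ht h = card (fst ` h) - 1"


section \<open>Schur polynomials\<close>

text \<open>
  The formal power series $e^{\sum_{i\ge1} t_i z^i}$ in \<open>z\<close>: the exponential series
  $\sum_m z^m/m!$ composed with $\sum_{i\ge1} t_i z^i$, which has no constant term
  (\<^const>\<open>fps_exp\<close> itself is only available over fields).
\<close>

definition schur_gf :: "'a::field_char_0 tpoly fps" where
  "schur_gf = fps_compose (Abs_fps (\<lambda>m. Const (1 / fact m)))
                (Abs_fps (\<lambda>i. if i = 0 then 0 else tvar i))"

definition elem_schur :: "int \<Rightarrow> 'a::field_char_0 tpoly" where
  "elem_schur k = (if k < 0 then 0 else fps_nth schur_gf (nat k))"

definition schur_det :: "nat \<Rightarrow> (nat \<Rightarrow> nat) \<Rightarrow> 'a::field_char_0 tpoly" where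
  "schur_det m lam = det (mat m m (\<lambda>(i, j). elem_schur (int (lam i) - int i + int j)))"

text \<open>The size \<open>m\<close> of the determinant can be any upper bound for the number of rows, see
  \<open>schur_det_eq_schur\<close> below.\<close>

definition schur :: "(nat \<Rightarrow> nat) \<Rightarrow> 'a::field_char_0 tpoly" where
  "schur lam = schur_det (nrows lam) lam"

lemma elem_schur_0: "elem_schur 0 = 1"
  by (simp add: elem_schur_def schur_gf_def fps_compose_nth Const_def)

lemma nonzero_rows:
  assumes "is_partition lam"
  shows "{r. lam r \<noteq> 0} = {..<nrows lam}"
proof -
  have fin: "finite {r. lam r \<noteq> 0}" and anti: "antimono lam"
    using assms by (auto simp: is_partition_def)
  obtain N where N: "\<not> lam N \<noteq> 0"
    using fin by (metis (mono_tags, lifting) ex_new_if_finite infinite_UNIV_nat mem_Collect_eq)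
  define L where "L = (LEAST r. lam r = 0)"
  have L: "lam L = 0" unfolding L_def using N by (metis (mono_tags) LeastI)
  have "{r. lam r \<noteq> 0} = {..<L}"
  proof (rule subset_antisym; rule subsetI)
    fix r assume "r \<in> {r. lam r \<noteq> 0}"
    then have "\<not> L \<le> r" using antimonoD[OF anti, of L r] L by auto
    then show "r \<in> {..<L}" by simp
  next
    fix r assume "r \<in> {..<L}"
    then show "r \<in> {r. lam r \<noteq> 0}" unfolding L_def using not_less_Least by auto
  qed
  then show ?thesis by (simp add: nrows_def)
qed

lemma schur_det_Suc:
  assumes "lam m = 0"
  shows "schur_det (Suc m) lam = schur_det m lam"
proof -
  let ?f = "\<lambda>(i, j). elem_schur (int (lam i) - int i + int j) :: 'a tpoly"
  let ?A = "mat (Suc m) (Suc m) ?f"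
  have del: "mat_delete ?A m m = mat m m ?f"
    by (rule eq_matI) (auto simp: mat_delete_def)
  have "det ?A = (\<Sum>j<Suc m. ?A $$ (m, j) * cofactor ?A m j)"
    by (rule laplace_expansion_row) auto
  also have "\<dots> = (\<Sum>j<Suc m. if j = m then cofactor ?A m m else 0)"
    using assms by (intro sum.cong) (auto simp: elem_schur_0, auto simp: elem_schur_def)
  also have "\<dots> = det (mat m m ?f)"
    unfolding cofactor_def del by simp
  finally show ?thesis by (simp add: schur_det_def)
qed

lemma schur_det_eq_schur:
  assumes "is_partition lam" "nrows lam \<le> m"
  shows "schur_det m lam = (schur lam :: 'a::field_char_0 tpoly)"
  using assms(2)
proof (induction m rule: dec_induct)
  case base
  then show ?case by (simp add: schur_def)
next
  case (step k)
  have "k \<notin> {r. lam r \<noteq> 0}" unfolding nonzero_rows[OF assms(1)] using step by simp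
  then have "schur_det (Suc k) lam = (schur_det k lam :: 'a tpoly)" by (intro schur_det_Suc) simp
  then show ?case using step by simp
qed


section \<open>Virasoro operators\<close>

text \<open>The middle sum is infinite, but only finitely many of its terms are nonzero
  (see \<open>finite_virasoro_support\<close>), so it is written with \<^const>\<open>Sum_any\<close>.\<close>

definition virasoro :: "int \<Rightarrow> 'a::field_char_0 tpoly \<Rightarrow> 'a tpoly" where
  "virasoro k f =
     Const (1/2) * (\<Sum>(i, j)\<in>{(i, j). 1 \<le> i \<and> 1 \<le> j \<and> int i + int j = k}. tderiv i (tderiv j f))
   + Sum_any (\<lambda>(i, j). of_nat i * tvar i * tderiv j f when 1 \<le> i \<and> 1 \<le> j \<and> - int i + int j = k)
   + Const (1/2) * (\<Sum>(i, j)\<in>{(i, j). 1 \<le> i \<and> 1 \<le> j \<and> - int i - int j = k}.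
       (of_nat i * tvar i) * (of_nat j * tvar j) * f)"

lemma finite_virasoro_support:
  "finite {p. (case p of (i, j) \<Rightarrow>
     of_nat i * tvar i * tderiv j f when 1 \<le> i \<and> 1 \<le> j \<and> - int i + int j = k) \<noteq> 0}"
proof (rule finite_subset)
  show "finite ((\<lambda>j. (nat (int j - k), j)) ` {j. tderiv j f \<noteq> 0})"
    using finite_tderiv_support by blast
next
  have "(i, j) \<in> (\<lambda>j. (nat (int j - k), j)) ` {j. tderiv j f \<noteq> 0}"
    if "tderiv j f \<noteq> 0" "- int i + int j = k" for i j
    using that by (intro image_eqI[of _ _ j]) auto
  moreover have "tderiv j f \<noteq> 0" if "of_nat i * tvar i * tderiv j f \<noteq> 0" for i j
    using that by (metis mult_zero_right)
  ultimately show "{p. (case p of (i, j) \<Rightarrow>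
      of_nat i * tvar i * tderiv j f when 1 \<le> i \<and> 1 \<le> j \<and> - int i + int j = k) \<noteq> 0}
    \<subseteq> (\<lambda>j. (nat (int j - k), j)) ` {j. tderiv j f \<noteq> 0}"
    unfolding when_def by (force split: if_splits)
qed

lemma finite_virasoro_index:
  "finite {(i, j). 1 \<le> i \<and> 1 \<le> j \<and> int i + int j = k}"
  "finite {(i, j). 1 \<le> i \<and> 1 \<le> j \<and> - int i - int j = k}"
proof -
  show "finite {(i, j). 1 \<le> i \<and> 1 \<le> j \<and> int i + int j = k}"
    by (rule finite_subset[of _ "{..nat k} \<times> {..nat k}"]) auto
  show "finite {(i, j). 1 \<le> i \<and> 1 \<le> j \<and> - int i - int j = k}"
    by (rule finite_subset[of _ "{..nat (-k)} \<times> {..nat (-k)}"]) auto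
qed


section \<open>The coefficients\<close>

text \<open>\<open>dcoef n lam mu\<close> is $d^{(-n)}_{\lambda\mu}$. The finiteness lemmas below show that all the
  sums involved are finite sums.\<close>

definition dcoef :: "nat \<Rightarrow> (nat \<Rightarrow> nat) \<Rightarrow> (nat \<Rightarrow> nat) \<Rightarrow> 'a::field_char_0" where
  "dcoef n lam mu =
     Sum_any (\<lambda>i. (\<Sum>nu | border_strip i lam nu \<and> border_strip (n + i) mu nu \<and>
                           skew lam nu \<subseteq> skew mu nu.
                     (-1) ^ (ht (skew lam nu) + ht (skew mu nu))) when 1 \<le> i)
   + 1/2 * (\<Sum>i = 1..n - 1. \<Sum>nu | border_strip i nu lam \<and> border_strip (n - i) mu nu.
                     (-1) ^ (ht (skew nu lam) + ht (skew mu nu)))"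

lemma finite_diagram:
  assumes "is_partition lam"
  shows "finite (diagram lam)"
proof -
  have "diagram lam = (SIGMA r:{r. lam r \<noteq> 0}. {..<lam r})"
    by (auto simp: diagram_def)
  then show ?thesis using assms by (simp add: is_partition_def finite_SigmaI)
qed

lemma finite_partitions_card:
  "finite {mu. is_partition mu \<and> card (diagram mu) = N}"
proof (rule finite_subset)
  let ?F = "{mu. \<forall>r. (r \<in> {..<N} \<longrightarrow> mu r \<in> {..N}) \<and> (r \<notin> {..<N} \<longrightarrow> mu r = (0::nat))}"
  show "finite ?F" by (rule finite_set_of_finite_funs) auto
  show "{mu. is_partition mu \<and> card (diagram mu) = N} \<subseteq> ?F"
  proof
    fix mu assume "mu \<in> {mu. is_partition mu \<and> card (diagram mu) = N}"
    then have p: "is_partition mu" and c: "card (diagram mu) = N" by auto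
    have anti: "antimono mu" using p by (simp add: is_partition_def)
    have "mu r \<le> N" for r
    proof -
      have "{r} \<times> {..<mu r} \<subseteq> diagram mu" by (auto simp: diagram_def)
      from card_mono[OF finite_diagram[OF p] this] show ?thesis using c by simp
    qed
    moreover have "r < N" if "mu r \<noteq> 0" for r
    proof -
      have "{..r} \<times> {0} \<subseteq> diagram mu"
        using that antimonoD[OF anti, of _ r] by (fastforce simp: diagram_def)
      from card_mono[OF finite_diagram[OF p] this] show ?thesis using c by simp
    qed
    ultimately show "mu \<in> ?F" by auto
  qed
qed

lemma border_strip_card:
  assumes "border_strip i \<alpha> \<beta>"
  shows "card (diagram \<alpha>) = card (diagram \<beta>) + i"
proof -
  have fin: "finite (diagram \<alpha>)" and sub: "diagram \<beta> \<subseteq> diagram \<alpha>"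
    and i: "card (diagram \<alpha> - diagram \<beta>) = i"
    using assms finite_diagram by (auto simp: border_strip_def skew_def)
  show ?thesis
    using i card_Diff_subset[OF finite_subset[OF sub fin] sub] card_mono[OF fin sub] by simp
qed

lemma finite_add_border_strip: "finite {mu. border_strip i mu lam}"
  by (rule finite_subset[OF _ finite_partitions_card[of "card (diagram lam) + i"]])
     (auto simp: border_strip_card, auto simp: border_strip_def)

lemma finite_remove_border_strip: "finite {mu. border_strip i lam mu}"
  by (rule finite_subset[OF _ finite_partitions_card[of "card (diagram lam) - i"]])
     (auto dest: border_strip_card, auto simp: border_strip_def)

lemma finite_dcoef_support:
  "finite {i. (\<Sum>nu | border_strip i lam nu \<and> border_strip (n + i) mu nu \<and>
                       skew lam nu \<subseteq> skew mu nu.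
                 (-1) ^ (ht (skew lam nu) + ht (skew mu nu)) :: 'a::field_char_0) \<noteq> 0}"
proof (rule finite_subset)
  show "finite {..card (diagram lam)}" by simp
next
  have le: "\<not> border_strip i lam nu" if "\<not> i \<le> card (diagram lam)" for i nu
    using that border_strip_card[of i lam nu] by auto
  show "{i. (\<Sum>nu | border_strip i lam nu \<and> border_strip (n + i) mu nu \<and>
                       skew lam nu \<subseteq> skew mu nu.
                 (-1) ^ (ht (skew lam nu) + ht (skew mu nu)) :: 'a) \<noteq> 0} \<subseteq> {..card (diagram lam)}"
    by (rule subsetI, rule ccontr) (simp add: le)
qed

end

theory Submission
  imports Defs
begin

text \<open>
  Place a bead at \<open>\<lambda>\<^sub>i - i\<close> for every row \<open>i\<close> of a partition. Adding a border strip with \<open>k\<close> boxes means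
  moving one bead up by \<open>k\<close> to a free position, and the height of the strip is the number of beads
  that it overtakes (\<open>bead_jump_border_strip\<close>, \<open>border_strip_bead_jump\<close>). So for every alternating
  function of the bead positions, the signed sum over all strips that can be added or removed is the
  plain sum over all beads, each shifted by \<open>k\<close> or \<open>- k\<close> (\<open>sum_add_border_strips\<close>,
  \<open>sum_remove_border_strips\<close>).

  The Jacobi-Trudi determinant is such a function. Because \<open>\<partial>\<^sub>j\<close> shifts the index of an elementary
  Schur polynomial by \<open>j\<close>, the product rule gives \<open>\<partial>\<^sub>j s\<^sub>\<lambda>\<close> as a signed sum over removals of strips of
  size \<open>j\<close>. Multiplication by \<open>k t\<^sub>k\<close> is the corresponding sum over additions
  (\<open>power_sum_times_jacobi_trudi\<close>); this is proved by comparing all partial derivatives, with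
  induction on the number of boxes. These are the Murnaghan-Nakayama rules.

  Applying them twice expands \<open>V\<^sub>\<plusminus>\<^sub>n s\<^sub>\<lambda>\<close> in Schur polynomials, with coefficients that are signed counts
  of two-step paths (\<open>path_coef\<close>). These agree with \<open>dcoef\<close> where the two partitions differ by a
  strip of size \<open>n\<close>. It remains to see that they vanish elsewhere (\<open>path_coef_zero\<close>). The
  coefficient is a sum of values of an alternating function, a determinant that indicates the target
  partition, over all configurations in which one bead moves by \<open>i\<close> and another one, or the same one,
  by \<open>n - i\<close>. If the same bead moves twice, the result is a single move by \<open>n\<close>, which does not lead to
  the target. If two beads move, exchanging their final positions permutes the possible values of
  \<open>i\<close> and changes the sign, so the total is 0 (\<open>two_bead_cancellation\<close>). The factor 1/2 of the
  quadratic terms matches the two orders in which two upward moves can be made, whereas a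
  downward move always comes first when a path is read from the smaller to the larger partition.
\<close>

section \<open>The partial derivatives as derivations\<close>

lemma Const_simps:
  "Const 0 = (0 :: 'a::comm_ring_1 tpoly)" "Const 1 = (1 :: 'a tpoly)"
  "Const (a + b) = (Const a + Const b :: 'a tpoly)"
  "Const (a * b) = (Const a * Const b :: 'a tpoly)"
  "Const (- a) = (- Const a :: 'a tpoly)"
  by (auto simp: Const_def single_add mult_single single_uminus)

lemma Const_power: "Const (a ^ k) = (Const a ^ k :: 'a::comm_ring_1 tpoly)"
  by (induction k) (auto simp: Const_simps)

lemma Const_minus_one_power: "Const ((-1) ^ k) = ((-1) ^ k :: 'a::comm_ring_1 tpoly)"
  by (simp add: Const_power Const_simps)

lemma Const_sum: "Const (sum f A) = (\<Sum>x\<in>A. Const (f x) :: 'a::comm_ring_1 tpoly)"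
  by (induction A rule: infinite_finite_induct) (auto simp: Const_simps)

lemma Const_of_nat: "Const (of_nat k) = (of_nat k :: 'a::comm_ring_1 tpoly)"
  by (simp add: Const_def)

lemma lookup_tderiv:
  "Poly_Mapping.lookup (tderiv i p) m =
     of_nat (Suc (Poly_Mapping.lookup m i)) * Poly_Mapping.lookup p (m + Poly_Mapping.single i 1)"
proof -
  let ?e = "Poly_Mapping.single i (1::nat)"
  have shift: "k - ?e = m \<longleftrightarrow> k = m + ?e" if "Poly_Mapping.lookup k i \<noteq> 0" for k
  proof
    assume *: "k - ?e = m"
    have "k = k - ?e + ?e"
      using that by (intro poly_mapping_eqI) (auto simp: lookup_add lookup_minus lookup_single when_def)
    then show "k = m + ?e" using * by simp
  qed simp
  have "Poly_Mapping.lookup (tderiv i p) m =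
      (\<Sum>k\<in>Poly_Mapping.keys p. of_nat (Poly_Mapping.lookup k i) * Poly_Mapping.lookup p k when k - ?e = m)"
    by (simp add: tderiv_def lookup_sum lookup_single)
  also have "\<dots> = (\<Sum>k\<in>Poly_Mapping.keys p.
      if k = m + ?e then of_nat (Poly_Mapping.lookup k i) * Poly_Mapping.lookup p k else 0)"
  proof (intro sum.cong refl)
    fix k
    show "(of_nat (Poly_Mapping.lookup k i) * Poly_Mapping.lookup p k when k - ?e = m) =
        (if k = m + ?e then of_nat (Poly_Mapping.lookup k i) * Poly_Mapping.lookup p k else 0)"
      using shift[of k] by (cases "Poly_Mapping.lookup k i = 0") auto
  qed
  also have "\<dots> = of_nat (Suc (Poly_Mapping.lookup m i)) * Poly_Mapping.lookup p (m + ?e)"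
    by (auto simp: sum.delta lookup_add in_keys_iff simp del: of_nat_Suc)
  finally show ?thesis .
qed

lemma tderiv_add: "tderiv i (p + q) = tderiv i p + tderiv i q"
  by (rule poly_mapping_eqI) (simp add: lookup_tderiv lookup_add algebra_simps)

lemma tderiv_0 [simp]: "tderiv i 0 = 0"
  by (simp add: tderiv_def)

lemma tderiv_sum: "tderiv i (sum f A) = (\<Sum>x\<in>A. tderiv i (f x))"
  by (induction A rule: infinite_finite_induct) (auto simp: tderiv_add)

lemma tderiv_single:
  "tderiv i (Poly_Mapping.single m c) =
     Poly_Mapping.single (m - Poly_Mapping.single i 1) (of_nat (Poly_Mapping.lookup m i) * c)"
  by (auto simp: tderiv_def)

lemma tderiv_Const [simp]: "tderiv i (Const c) = 0"
  by (simp add: Const_def tderiv_single)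

lemma tderiv_1 [simp]: "tderiv i (1 :: 'a::comm_ring_1 tpoly) = 0"
  by (simp flip: Const_simps(2))

lemma tderiv_tvar:
  "tderiv i (tvar j) = (if i = j then 1 else 0 :: 'a::comm_ring_1 tpoly)"
  by (simp add: tvar_def tderiv_single lookup_single)

lemma poly_mapping_eq_sum_single:
  "(\<Sum>m\<in>Poly_Mapping.keys p. Poly_Mapping.single m (Poly_Mapping.lookup p m)) = p"
  by (rule poly_mapping_eqI) (auto simp: lookup_sum lookup_single when_def in_keys_iff)

lemma tderiv_mult_single:
  fixes c d :: "'a::comm_ring_1"
  shows "tderiv i (Poly_Mapping.single m c * Poly_Mapping.single k d) =
    tderiv i (Poly_Mapping.single m c) * Poly_Mapping.single k d +
    Poly_Mapping.single m c * tderiv i (Poly_Mapping.single k d)"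
proof -
  let ?e = "Poly_Mapping.single i (1::nat)"
  (* The truncating subtraction of exponents is harmless because the coefficient is then 0. *)
  have *: "Poly_Mapping.single (m - ?e + k) (of_nat (Poly_Mapping.lookup m i) * c * d) =
      Poly_Mapping.single (m + k - ?e) (of_nat (Poly_Mapping.lookup m i) * c * d)" for m k c d
  proof (cases "Poly_Mapping.lookup m i = 0")
    case False
    then have "m - ?e + k = m + k - ?e"
      by (intro poly_mapping_eqI) (auto simp: lookup_add lookup_minus lookup_single when_def)
    then show ?thesis by simp
  qed simp
  show ?thesis
    using *[of m k c d] *[of k m d c]
    by (simp add: tderiv_single mult_single lookup_add single_add[symmetric] algebra_simps)
qed

lemma tderiv_mult:
  fixes p q :: "'a::comm_ring_1 tpoly"
  shows "tderiv i (p * q) = tderiv i p * q + p * tderiv i q"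
proof -
  let ?s = "\<lambda>p m. Poly_Mapping.single m (Poly_Mapping.lookup p m)"
  have "tderiv i ((\<Sum>m\<in>Poly_Mapping.keys p. ?s p m) * (\<Sum>k\<in>Poly_Mapping.keys q. ?s q k)) =
    tderiv i (\<Sum>m\<in>Poly_Mapping.keys p. ?s p m) * (\<Sum>k\<in>Poly_Mapping.keys q. ?s q k) +
    (\<Sum>m\<in>Poly_Mapping.keys p. ?s p m) * tderiv i (\<Sum>k\<in>Poly_Mapping.keys q. ?s q k)"
    by (simp only: sum_product tderiv_sum tderiv_mult_single sum.distrib)
  then show ?thesis by (simp only: poly_mapping_eq_sum_single)
qed

lemma tderiv_uminus: "tderiv i (- p) = (- tderiv i p :: 'a::comm_ring_1 tpoly)"
  by (rule poly_mapping_eqI) (simp add: lookup_tderiv)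

lemma tderiv_diff: "tderiv i (p - q) = (tderiv i p - tderiv i q :: 'a::comm_ring_1 tpoly)"
  using tderiv_add[of i p "-q"] by (simp add: tderiv_uminus)

lemma tderiv_of_nat [simp]: "tderiv i (of_nat k :: 'a::comm_ring_1 tpoly) = 0"
  by (simp flip: Const_of_nat)

lemma tderiv_Const_mult: "tderiv i (Const c * p) = (Const c * tderiv i p :: 'a::comm_ring_1 tpoly)"
  by (simp add: tderiv_mult)

lemma tderiv_minus_one_power_mult:
  "tderiv i ((-1) ^ k * p) = ((-1) ^ k * tderiv i p :: 'a::comm_ring_1 tpoly)"
  by (simp add: tderiv_Const_mult flip: Const_minus_one_power)

lemma tderiv_prod:
  fixes f :: "'b \<Rightarrow> 'a::comm_ring_1 tpoly"
  assumes "finite A"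
  shows "tderiv j (\<Prod>x\<in>A. f x) = (\<Sum>r\<in>A. \<Prod>x\<in>A. if x = r then tderiv j (f x) else f x)"
  using assms
proof (induction A)
  case (insert a A)
  have 1: "(\<Prod>x\<in>insert a A. if x = a then tderiv j (f x) else f x) = tderiv j (f a) * prod f A"
    using insert by (simp, intro arg_cong2[of _ _ _ _ "(*)"] prod.cong) auto
  have 2: "(\<Prod>x\<in>insert a A. if x = r then tderiv j (f x) else f x) =
      f a * (\<Prod>x\<in>A. if x = r then tderiv j (f x) else f x)" if "r \<in> A" for r
    using insert that by auto
  have "(\<Sum>r\<in>insert a A. \<Prod>x\<in>insert a A. if x = r then tderiv j (f x) else f x) =
      tderiv j (f a) * prod f A + (\<Sum>r\<in>A. f a * (\<Prod>x\<in>A. if x = r then tderiv j (f x) else f x))"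
    unfolding sum.insert[OF insert(1,2)] 1 by (simp only: 2 cong: sum.cong)
  also have "\<dots> = tderiv j (f a) * prod f A + f a * tderiv j (prod f A)"
    by (simp only: insert.IH sum_distrib_left)
  also have "\<dots> = tderiv j (prod f (insert a A))"
    by (simp only: prod.insert[OF insert(1,2)] tderiv_mult)
  finally show ?case by (rule sym)
qed simp

text \<open>A monomial of positive degree contains some variable, and the derivative in this variable
  keeps its coefficient up to a positive integer factor.\<close>

lemma constant_if_tderivs_zero:
  fixes p :: "'a::field_char_0 tpoly"
  assumes "\<And>j. tderiv j p = 0"
  shows "p = Const (Poly_Mapping.lookup p 0)"
proof (rule poly_mapping_eqI)
  fix m
  show "Poly_Mapping.lookup p m = Poly_Mapping.lookup (Const (Poly_Mapping.lookup p 0)) m"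
  proof (cases "m = 0")
    case False
    then obtain i where i: "Poly_Mapping.lookup m i \<noteq> 0"
      by (metis lookup_zero poly_mapping_eqI)
    let ?e = "Poly_Mapping.single i (1::nat)"
    have m: "m - ?e + ?e = m"
      using i by (intro poly_mapping_eqI) (auto simp: lookup_add lookup_minus lookup_single when_def)
    have "Poly_Mapping.lookup (tderiv i p) (m - ?e) = 0" by (simp add: assms)
    then have "Poly_Mapping.lookup p m = 0"
      unfolding lookup_tderiv m by (simp del: of_nat_Suc)
    then show ?thesis using False by (simp add: Const_def lookup_single)
  qed (simp add: Const_def)
qed

lemma lookup_0_mult:
  "Poly_Mapping.lookup (p * q) 0 = Poly_Mapping.lookup p 0 * Poly_Mapping.lookup q 0"
  for p q :: "'a::comm_ring_1 tpoly"
proof -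
  have z: "m + k = 0 \<longleftrightarrow> m = 0 \<and> k = 0" for m k :: "nat \<Rightarrow>\<^sub>0 nat"
    by (auto simp: poly_mapping_eq_iff fun_eq_iff lookup_add)
  let ?s = "\<lambda>p m. Poly_Mapping.single m (Poly_Mapping.lookup p m)"
  have 1: "Poly_Mapping.lookup (?s p m * ?s q k) 0 =
      (if m = 0 then Poly_Mapping.lookup p 0 else 0) * (if k = 0 then Poly_Mapping.lookup q 0 else 0)" for m k
    by (auto simp: mult_single lookup_single z when_def)
  have "p * q = (\<Sum>m\<in>Poly_Mapping.keys p. ?s p m) * (\<Sum>k\<in>Poly_Mapping.keys q. ?s q k)"
    by (simp only: poly_mapping_eq_sum_single)
  also have "Poly_Mapping.lookup \<dots> 0 = Poly_Mapping.lookup p 0 * Poly_Mapping.lookup q 0"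
    unfolding sum_product lookup_sum 1 by (auto simp: in_keys_iff simp flip: sum_product)
  finally show ?thesis .
qed

lemma lookup_0_prod:
  "Poly_Mapping.lookup (prod f A) 0 = (\<Prod>x\<in>A. Poly_Mapping.lookup (f x) 0)"
  for f :: "_ \<Rightarrow> 'a::comm_ring_1 tpoly"
  by (induction A rule: infinite_finite_induct) (auto simp: lookup_0_mult lookup_one)


section \<open>Derivatives of the elementary Schur polynomials\<close>

definition fps_tderiv :: "nat \<Rightarrow> 'a::comm_ring_1 tpoly fps \<Rightarrow> 'a tpoly fps" where
  "fps_tderiv j f = Abs_fps (\<lambda>n. tderiv j (fps_nth f n))"

lemma fps_tderiv_mult: "fps_tderiv j (f * g) = fps_tderiv j f * g + f * fps_tderiv j g"
  by (rule fps_ext) (simp add: fps_tderiv_def fps_mult_nth tderiv_sum tderiv_mult sum.distrib)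

lemma fps_tderiv_power:
  "fps_tderiv j (f ^ Suc m) = of_nat (Suc m) * fps_tderiv j f * f ^ m"
proof (induction m)
  case (Suc m)
  have "fps_tderiv j (f ^ Suc (Suc m)) = fps_tderiv j f * f ^ Suc m + f * fps_tderiv j (f ^ Suc m)"
    by (simp only: power_Suc[of f "Suc m"] fps_tderiv_mult)
  also have "\<dots> = of_nat (Suc (Suc m)) * fps_tderiv j f * f ^ Suc m"
    unfolding Suc by (simp add: algebra_simps)
  finally show ?case .
qed simp

text \<open>Differentiating \<open>exp (\<Sum>\<^sub>i t\<^sub>i z\<^sup>i)\<close> in \<open>t\<^sub>j\<close> multiplies it by \<open>z\<^sup>j\<close>.\<close>

lemma tderiv_elem_schur:
  assumes "j \<ge> 1"
  shows "tderiv j (elem_schur k) = (elem_schur (k - int j) :: 'a::field_char_0 tpoly)"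
proof (cases "k < 0")
  case False
  define T :: "'a tpoly fps" where "T = Abs_fps (\<lambda>i. if i = 0 then 0 else tvar i)"
  define n where "n = nat k"
  have k: "k = int n" using False by (simp add: n_def)
  have dT: "fps_tderiv j T = fps_X ^ j"
    using assms by (intro fps_ext) (auto simp: fps_tderiv_def T_def fps_X_power_nth tderiv_tvar)
  have low: "fps_nth (T ^ m) i = 0" if "i < m" for i m
    using startsby_zero_power_prefix[of T m] that by (simp add: T_def)
  have c: "Const (1 / fact (Suc m)) * of_nat (Suc m) = (Const (1 / fact m) :: 'a tpoly)" for m
    by (simp add: field_simps del: of_nat_Suc flip: Const_simps Const_of_nat)
  have of_nat_nth: "fps_nth (of_nat a * f) i = of_nat a * fps_nth f i" for a f and i :: nat
    by (simp flip: fps_of_nat)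
  have E: "elem_schur (int i) = (\<Sum>m=0..i. Const (1 / fact m) * fps_nth (T ^ m) i)" for i
    by (simp add: elem_schur_def schur_gf_def fps_compose_nth T_def)
  have "tderiv j (elem_schur k) = (\<Sum>m=0..n. Const (1 / fact m) * fps_nth (fps_tderiv j (T ^ m)) n)"
    by (simp add: k E tderiv_sum tderiv_Const_mult fps_tderiv_def)
  also have "\<dots> = (\<Sum>m\<in>{1..n}. Const (1 / fact m) * fps_nth (fps_tderiv j (T ^ m)) n)"
    by (rule sum.mono_neutral_right) (auto simp: fps_tderiv_def not_le split: if_splits)
  also have "\<dots> = (\<Sum>m<n. Const (1 / fact (Suc m)) * fps_nth (fps_tderiv j (T ^ Suc m)) n)"
    by (rule sum.reindex_bij_witness[of _ Suc "\<lambda>m. m - 1"]) auto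
  also have "\<dots> = (\<Sum>m<n. Const (1 / fact m) * fps_nth (fps_X ^ j * T ^ m) n)"
    unfolding fps_tderiv_power dT mult.assoc of_nat_nth
    by (simp only: mult.assoc[symmetric] c)
  also have "\<dots> = elem_schur (k - int j)"
  proof (cases "n < j")
    case True
    then show ?thesis by (simp add: fps_X_power_mult_nth k elem_schur_def)
  next
    case False
    have "(\<Sum>m<n. Const (1 / fact m) * fps_nth (fps_X ^ j * T ^ m) n) =
        (\<Sum>m=0..n - j. Const (1 / fact m) * fps_nth (T ^ m) (n - j))"
      using False assms by (intro sum.mono_neutral_cong_right) (auto simp: fps_X_power_mult_nth low)
    also have "\<dots> = elem_schur (k - int j)"
      using E[of "n - j"] False by (simp add: k of_nat_diff)
    finally show ?thesis .
  qed
  finally show ?thesis .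
qed (simp add: elem_schur_def)

lemma tderiv_0_elem_schur: "tderiv 0 (elem_schur k) = (0 :: 'a::field_char_0 tpoly)"
proof (cases "k < 0")
  case False
  define T :: "'a tpoly fps" where "T = Abs_fps (\<lambda>i. if i = 0 then 0 else tvar i)"
  have dT: "fps_tderiv 0 T = 0"
    by (intro fps_ext) (auto simp: fps_tderiv_def T_def tderiv_tvar)
  have "tderiv 0 (fps_nth (T ^ m) i) = 0" for m i
  proof -
    have "fps_nth (fps_tderiv 0 (T ^ m)) i = 0"
    proof (cases m)
      case (Suc l)
      then show ?thesis by (simp only: fps_tderiv_power dT) simp
    qed (simp add: fps_tderiv_def)
    then show ?thesis by (simp add: fps_tderiv_def)
  qed
  then show ?thesis
    using False by (simp add: elem_schur_def schur_gf_def fps_compose_nth tderiv_sum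
      tderiv_Const_mult flip: T_def)
qed (simp add: elem_schur_def)

lemma lookup_0_elem_schur:
  "Poly_Mapping.lookup (elem_schur k :: 'a::field_char_0 tpoly) 0 = (if k = 0 then 1 else 0)"
proof (cases "k \<le> 0")
  case True
  then show ?thesis by (cases "k = 0") (simp add: elem_schur_0 lookup_one, simp add: elem_schur_def)
next
  case False
  define T :: "'a tpoly fps" where "T = Abs_fps (\<lambda>i. if i = 0 then 0 else tvar i)"
  have T: "Poly_Mapping.lookup (fps_nth T i) 0 = 0" for i
    by (auto simp: T_def tvar_def lookup_single when_def poly_mapping_eq_iff fun_eq_iff)
  have P: "Poly_Mapping.lookup (fps_nth (T ^ Suc m) i) 0 = 0" for m i
    by (simp add: fps_mult_nth lookup_sum lookup_0_mult T)
  have "Poly_Mapping.lookup (Const (1 / fact m) * fps_nth (T ^ m) (nat k)) 0 = (0::'a)" for m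
    using False P by (cases m) (auto simp: lookup_0_mult simp del: power_Suc)
  then show ?thesis
    using False by (simp add: elem_schur_def schur_gf_def fps_compose_nth lookup_sum flip: T_def)
qed


section \<open>Beads and border strips\<close>

text \<open>A partition is recorded by the strictly decreasing integers \<open>\<lambda>\<^sub>i - i\<close>, the positions of the
  beads on an abacus. An empty row \<open>i\<close> contributes the bead \<open>- i\<close>.\<close>

definition beads :: "(nat \<Rightarrow> nat) \<Rightarrow> nat \<Rightarrow> int" where
  "beads lam i = int (lam i) - int i"

lemma beads_eq_iff: "beads lam = beads mu \<longleftrightarrow> lam = mu"
  by (auto simp: beads_def fun_eq_iff)

lemma is_partition_antimono: "is_partition lam \<Longrightarrow> i \<le> j \<Longrightarrow> lam j \<le> lam i"
  by (simp add: is_partition_def antimonoD)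

lemma beads_less: "is_partition lam \<Longrightarrow> i < j \<Longrightarrow> beads lam j < beads lam i"
  using is_partition_antimono[of lam i j] by (simp add: beads_def)

lemma beads_inj: "is_partition lam \<Longrightarrow> beads lam i = beads lam j \<longleftrightarrow> i = j"
  using beads_less[of lam i j] beads_less[of lam j i] by (cases i j rule: linorder_cases) auto

lemma beads_beyond:
  assumes "is_partition lam" "nrows lam \<le> i"
  shows "beads lam i = - int i"
proof -
  have "i \<notin> {r. lam r \<noteq> 0}" unfolding nonzero_rows[OF assms(1)] using assms(2) by simp
  then show ?thesis by (simp add: beads_def)
qed

lemma beads_surj:
  assumes dec: "\<And>i. c (Suc i) < c i" and tail: "\<And>i. i \<ge> N \<Longrightarrow> c i = - int i"
  shows "\<exists>mu. is_partition mu \<and> beads mu = c"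
proof -
  define mu where "mu i = nat (c i + int i)" for i
  have nonneg: "c i + int i \<ge> 0" for i
  proof (cases "i \<le> N")
    case True
    then show ?thesis
    proof (induction rule: inc_induct)
      case (step l)
      then show ?case using dec[of l] by simp
    qed (simp add: tail)
  qed (simp add: tail)
  have "mu (Suc i) \<le> mu i" for i using dec[of i] by (auto simp: mu_def)
  then have "antimono mu" by (simp add: antimono_iff_le_Suc)
  moreover have "{r. mu r \<noteq> 0} \<subseteq> {..<N}"
  proof
    fix r assume "r \<in> {r. mu r \<noteq> 0}"
    then have "\<not> N \<le> r" using tail[of r] by (auto simp: mu_def)
    then show "r \<in> {..<N}" by simp
  qed
  then have "finite {r. mu r \<noteq> 0}" using finite_subset by blast
  moreover have "beads mu = c" using nonneg by (auto simp: beads_def mu_def)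
  ultimately show ?thesis unfolding is_partition_def by blast
qed

text \<open>The entry in position \<open>r\<close> is inserted in position \<open>s \<le> r\<close>, by a cyclic rotation of the segment
  between them.\<close>

definition slide :: "nat \<Rightarrow> nat \<Rightarrow> (nat \<Rightarrow> 'b) \<Rightarrow> nat \<Rightarrow> 'b" where
  "slide s r c = (\<lambda>i. if i = s then c r else if s < i \<and> i \<le> r then c (i - 1) else c i)"

text \<open>A single bead of \<open>lam\<close> moves up by \<open>k\<close>. The index of the bead drops from \<open>r\<close> to \<open>s\<close> because it
  overtakes \<open>r - s\<close> other beads, and this rotation is what produces the sign of a border strip.\<close>

definition bead_jump :: "nat \<Rightarrow> nat \<Rightarrow> nat \<Rightarrow> (nat \<Rightarrow> nat) \<Rightarrow> (nat \<Rightarrow> nat) \<Rightarrow> bool" where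
  "bead_jump k s r lam mu \<longleftrightarrow>
     s \<le> r \<and> beads mu = slide s r ((beads lam)(r := beads lam r + int k))"

lemma bead_jump_iff_rows:
  "bead_jump k s r lam mu \<longleftrightarrow> s \<le> r \<and>
     (\<forall>i. i < s \<or> r < i \<longrightarrow> mu i = lam i) \<and>
     (\<forall>i. s < i \<and> i \<le> r \<longrightarrow> mu i = Suc (lam (i - 1))) \<and>
     int (mu s) - int (lam r) + int (r - s) = int k"
proof (cases "s \<le> r")
  case True
  have "(beads mu i = slide s r ((beads lam)(r := beads lam r + int k)) i) \<longleftrightarrow>
      (if i = s then int (mu s) - int (lam r) + int (r - s) = int k
       else if s < i \<and> i \<le> r then mu i = Suc (lam (i - 1)) else mu i = lam i)" for i
  proof (cases "s < i \<and> i \<le> r")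
    case True
    then obtain j where "i = Suc j" by (cases i) auto
    then show ?thesis using True by (auto simp: slide_def beads_def)
  next
    case False
    then have "slide s r c i = (if i = s then c r else c i)" for c :: "nat \<Rightarrow> int"
      by (auto simp: slide_def)
    then show ?thesis using \<open>s \<le> r\<close> False by (auto simp: beads_def of_nat_diff)
  qed
  then have "bead_jump k s r lam mu \<longleftrightarrow> (\<forall>i. if i = s then int (mu s) - int (lam r) + int (r - s) = int k
       else if s < i \<and> i \<le> r then mu i = Suc (lam (i - 1)) else mu i = lam i)"
    using True by (simp add: bead_jump_def fun_eq_iff)
  also have "\<dots> \<longleftrightarrow> s \<le> r \<and> (\<forall>i. i < s \<or> r < i \<longrightarrow> mu i = lam i) \<and>
     (\<forall>i. s < i \<and> i \<le> r \<longrightarrow> mu i = Suc (lam (i - 1))) \<and>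
     int (mu s) - int (lam r) + int (r - s) = int k" (is "(\<forall>i. ?P i) \<longleftrightarrow> ?Q")
  proof
    assume P: "\<forall>i. ?P i"
    show ?Q
    proof (intro conjI allI impI)
      show "mu i = lam i" if "i < s \<or> r < i" for i using P[rule_format, of i] that True by auto
      show "mu i = Suc (lam (i - 1))" if "s < i \<and> i \<le> r" for i using P[rule_format, of i] that by auto
      show "int (mu s) - int (lam r) + int (r - s) = int k" using P[rule_format, of s] by simp
    qed (rule True)
  next
    assume Q: ?Q
    show "\<forall>i. ?P i"
    proof
      fix i
      show "?P i" using Q by (cases "i < s"; cases "i \<le> r") auto
    qed
  qed
  finally show ?thesis .
qed (simp add: bead_jump_def)

lemma sum_row_gaps:
  fixes lam mu :: "nat \<Rightarrow> nat"
  assumes "s \<le> r" and "\<And>i. s < i \<Longrightarrow> i \<le> r \<Longrightarrow> mu i = Suc (lam (i - 1))"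
  shows "(\<Sum>i=s..r. int (mu i) - int (lam i)) = int (mu s) - int (lam r) + int (r - s)"
  using assms
proof (induction r rule: dec_induct)
  case (step l)
  have "(\<Sum>i=s..l. int (mu i) - int (lam i)) = int (mu s) - int (lam l) + int (l - s)"
    by (rule step.IH) (simp add: step.prems)
  moreover have "mu (Suc l) = Suc (lam l)" using step.prems[of "Suc l"] step.hyps by simp
  ultimately show ?case using step.hyps by (simp add: Suc_diff_le)
qed simp

lemma card_skew_rows:
  assumes "s \<le> r"
    and "\<And>i. i < s \<or> r < i \<Longrightarrow> mu i = lam i"
    and "\<And>i. s < i \<Longrightarrow> i \<le> r \<Longrightarrow> mu i = Suc (lam (i - 1))"
    and le: "\<And>i. lam i \<le> mu i"
  shows "int (card (skew mu lam)) = int (mu s) - int (lam r) + int (r - s)"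
proof -
  have "(i, c) \<in> skew mu lam \<longleftrightarrow> (i, c) \<in> (SIGMA i:{s..r}. {lam i..<mu i})" for i c
  proof (cases "s \<le> i \<and> i \<le> r")
    case False
    then have "mu i = lam i" using assms(2)[of i] by (meson not_le)
    then show ?thesis using False by (simp add: skew_def diagram_def)
  qed (auto simp: skew_def diagram_def)
  then have "skew mu lam = (SIGMA i:{s..r}. {lam i..<mu i})"
    unfolding set_eq_iff split_paired_All by blast
  then have "int (card (skew mu lam)) = (\<Sum>i=s..r. int (mu i) - int (lam i))"
    using le by (simp add: of_nat_diff)
  also have "\<dots> = int (mu s) - int (lam r) + int (r - s)"
    by (rule sum_row_gaps) (fact assms)+
  finally show ?thesis .
qed

text \<open>The rows \<open>s, \<dots>, r\<close> are exactly those in which \<open>lam\<close> and \<open>mu\<close> differ, so \<open>s\<close> and \<open>r\<close> can be recovered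
  from the two partitions.\<close>

lemma bead_jump_row_less_iff:
  assumes jump: "bead_jump k s r lam mu" and "k \<ge> 1" "is_partition lam" "is_partition mu"
  shows "lam i < mu i \<longleftrightarrow> s \<le> i \<and> i \<le> r"
proof -
  note rows = jump[unfolded bead_jump_iff_rows]
  have inside: "lam i < mu i" if i: "s \<le> i" "i \<le> r"
  proof (cases "i = s")
    case False
    then have "mu i = Suc (lam (i - 1))" using rows i by auto
    then show ?thesis using is_partition_antimono[OF assms(3), of "i - 1" i] by simp
  next
    case True
    show ?thesis
    proof (cases "s = r")
      case False
      then have "mu (Suc s) = Suc (lam s)" using rows by auto
      then show ?thesis using is_partition_antimono[OF assms(4), of s "Suc s"] True by simp
    qed (use rows \<open>k \<ge> 1\<close> True in auto)
  qed
  show ?thesis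
  proof (cases "s \<le> i \<and> i \<le> r")
    case False
    then have "mu i = lam i" using rows by (meson not_le)
    then show ?thesis using False by simp
  qed (simp add: inside)
qed

lemma rtrancl_crosses:
  assumes "(x, y) \<in> R\<^sup>*" "P x" "\<not> P y"
  shows "\<exists>u v. (u, v) \<in> R \<and> P u \<and> \<not> P v"
  using assms
proof (induction rule: rtrancl_induct)
  case (step y z)
  then show ?case by (cases "P y") auto
qed simp

text \<open>A jump over \<open>r - s\<close> beads adds a border strip in the rows \<open>s, \<dots>, r\<close>: the relation
  \<open>\<mu>\<^sub>i = \<lambda>\<^sub>i\<^sub>-\<^sub>1 + 1\<close> says that two consecutive rows of the strip share exactly one column.\<close>

lemma bead_jump_border_strip:
  assumes jump: "bead_jump k s r lam mu" and k: "k \<ge> 1"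
    and lam: "is_partition lam" and mu: "is_partition mu"
  shows "border_strip k mu lam" and "ht (skew mu lam) = r - s"
proof -
  note rows = jump[unfolded bead_jump_iff_rows]
  note less = bead_jump_row_less_iff[OF jump k lam mu]
  have le: "lam i \<le> mu i" for i
  proof (cases "s \<le> i \<and> i \<le> r")
    case False
    then have "mu i = lam i" using rows by (meson not_le)
    then show ?thesis by simp
  qed (use less[of i] in simp)
  have mem: "(i, c) \<in> skew mu lam \<longleftrightarrow> s \<le> i \<and> i \<le> r \<and> lam i \<le> c \<and> c < mu i" for i c
    using less[of i] by (auto simp: skew_def diagram_def)
  have fst: "fst ` skew mu lam = {s..r}"
  proof (rule subset_antisym; rule subsetI)
    fix i assume "i \<in> {s..r}"
    then have "(i, lam i) \<in> skew mu lam" using less[of i] by (simp add: mem)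
    then show "i \<in> fst ` skew mu lam" by force
  qed (auto simp: mem)
  show "ht (skew mu lam) = r - s"
    using rows by (simp add: ht_def fst)
  have "int (card (skew mu lam)) = int (mu s) - int (lam r) + int (r - s)"
    by (rule card_skew_rows) (use rows le in blast)+
  then have card: "int (card (skew mu lam)) = int k" using rows by (elim conjE) linarith
  define R where "R = {(u, v). u \<in> skew mu lam \<and> v \<in> skew mu lam \<and> adjacent u v}"
  have sym: "sym (R\<^sup>*)"
    by (intro sym_rtrancl) (auto simp: R_def sym_def adjacent_def)
  have left: "((i, c), (i, lam i)) \<in> R\<^sup>*" if "(i, c) \<in> skew mu lam" for i c
    using that
  proof (induction c)
    case (Suc c)
    show ?case
    proof (cases "lam i = Suc c")
      case False
      then have c: "(i, c) \<in> skew mu lam" using Suc.prems by (auto simp: mem)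
      then have "((i, Suc c), (i, c)) \<in> R" using Suc.prems by (auto simp: R_def adjacent_def)
      then show ?thesis using Suc.IH[OF c] by (rule converse_rtrancl_into_rtrancl)
    qed simp
  qed (auto simp: mem)
  have down: "((i, lam i), (r, lam r)) \<in> R\<^sup>*" if "s \<le> i" "i \<le> r" for i
    using that(2,1)
  proof (induction rule: inc_induct)
    case (step i)
    have m: "mu (Suc i) = Suc (lam i)" using rows step by auto
    have *: "(Suc i, lam i) \<in> skew mu lam"
      using step m is_partition_antimono[OF lam, of i "Suc i"] by (auto simp: mem)
    moreover have "(i, lam i) \<in> skew mu lam" using step less[of i] by (auto simp: mem)
    ultimately have "((i, lam i), (Suc i, lam i)) \<in> R" by (simp add: R_def adjacent_def)
    also have "((Suc i, lam i), (Suc i, lam (Suc i))) \<in> R\<^sup>*" by (rule left[OF *])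
    also have "((Suc i, lam (Suc i)), (r, lam r)) \<in> R\<^sup>*" using step by simp
    finally show ?case by simp
  qed simp
  have root: "(x, (r, lam r)) \<in> R\<^sup>*" if "x \<in> skew mu lam" for x
  proof -
    obtain i c where x: "x = (i, c)" by (cases x)
    then show ?thesis
      using rtrancl_trans[OF left[of i c] down[of i]] that by (auto simp: mem)
  qed
  have "(x, y) \<in> R\<^sup>*" if "x \<in> skew mu lam" "y \<in> skew mu lam" for x y
    by (rule rtrancl_trans[OF root symD[OF sym root]]) (use that in auto)
  then have "connected_boxes (skew mu lam)" by (simp add: connected_boxes_def R_def)
  moreover have "\<not> {(i, c), (i, Suc c), (Suc i, c), (Suc i, Suc c)} \<subseteq> skew mu lam" for i c
  proof
    assume "{(i, c), (i, Suc c), (Suc i, c), (Suc i, Suc c)} \<subseteq> skew mu lam"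
    then have "s \<le> i" "Suc i \<le> r" "lam i \<le> c" "Suc c < mu (Suc i)" by (auto simp: mem)
    moreover have "mu (Suc i) = Suc (lam i)" using rows calculation by auto
    ultimately show False by simp
  qed
  moreover have "skew mu lam \<noteq> {}" using card k by force
  moreover have "diagram lam \<subseteq> diagram mu"
    using le by (auto simp: diagram_def intro: less_le_trans)
  ultimately show "border_strip k mu lam"
    using card lam mu by (simp add: border_strip_def)
qed

text \<open>Connectedness forces two consecutive rows of the strip to share at least one column, and the
  absence of a \<open>2 \<times> 2\<close> square forces them to share at most one. Hence every changed row of \<open>mu\<close>
  except the first is as long as the row of \<open>lam\<close> above it plus one box.\<close>

lemma border_strip_bead_jump:
  assumes strip: "border_strip k mu lam"
  shows "k \<ge> 1" and "\<exists>s r. bead_jump k s r lam mu"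
proof -
  let ?S = "skew mu lam"
  have mu: "is_partition mu" and lam: "is_partition lam" and sub: "diagram lam \<subseteq> diagram mu"
    and ne: "?S \<noteq> {}" and conn: "connected_boxes ?S"
    and no_square: "\<And>i c. \<not> {(i, c), (i, Suc c), (Suc i, c), (Suc i, Suc c)} \<subseteq> ?S"
    and card: "card ?S = k"
    using strip by (auto simp: border_strip_def)
  have fin: "finite ?S" using finite_diagram[OF mu] by (simp add: skew_def)
  show "k \<ge> 1" using card fin ne by (metis One_nat_def Suc_leI card_gt_0_iff)
  have mem: "(i, c) \<in> ?S \<longleftrightarrow> lam i \<le> c \<and> c < mu i" for i c
    by (auto simp: skew_def diagram_def)
  have le: "lam i \<le> mu i" for i
  proof (rule ccontr)
    assume "\<not> lam i \<le> mu i"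
    then have "(i, mu i) \<in> diagram lam" by (simp add: diagram_def)
    then show False using sub by (auto simp: diagram_def)
  qed
  define s r where "s = Min (fst ` ?S)" and "r = Max (fst ` ?S)"
  have "s \<in> fst ` ?S" "r \<in> fst ` ?S" using fin ne by (auto simp: s_def r_def)
  then obtain c d where ends: "(s, c) \<in> ?S" "(r, d) \<in> ?S" by auto
  have bounds: "s \<le> i \<and> i \<le> r" if "(i, e) \<in> ?S" for i e
    unfolding s_def r_def using fin that by (force intro: Min_le Max_ge)
  have sr: "s \<le> r" using bounds ends by blast
  have outside: "mu i = lam i" if "i < s \<or> r < i" for i
  proof -
    have "\<not> lam i < mu i" using bounds[of i "lam i"] that by (auto simp: mem)
    then show ?thesis using le[of i] by simp
  qed
  have step': "mu (Suc i) = Suc (lam i)" if i: "s \<le> i" "i < r" for i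
  proof -
    define R where "R = {(u, v). u \<in> ?S \<and> v \<in> ?S \<and> adjacent u v}"
    have "((s, c), (r, d)) \<in> R\<^sup>*" using conn ends by (simp add: connected_boxes_def R_def)
    from rtrancl_crosses[OF this, of "\<lambda>u. fst u \<le> i"] i obtain u v
      where uv: "(u, v) \<in> R" "fst u \<le> i" "\<not> fst v \<le> i" by auto
    then have "fst u = i" "fst v = Suc i" "snd u = snd v"
      by (auto simp: R_def adjacent_def)
    then have "(i, snd u) \<in> ?S" "(Suc i, snd u) \<in> ?S"
      using uv(1) by (cases u; cases v; auto simp: R_def)+
    then have "lam i < mu (Suc i)" by (auto simp: mem)
    moreover have "\<not> Suc (lam i) < mu (Suc i)"
      using no_square[of i "lam i"] is_partition_antimono[OF lam, of i "Suc i"]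
        is_partition_antimono[OF mu, of i "Suc i"] by (auto simp: mem)
    ultimately show ?thesis by simp
  qed
  have step: "mu i = Suc (lam (i - 1))" if "s < i" "i \<le> r" for i
    using that step'[of "i - 1"] by (cases i) auto
  have "int (card ?S) = int (mu s) - int (lam r) + int (r - s)"
    by (rule card_skew_rows) (fact sr outside step le)+
  then have "bead_jump k s r lam mu"
    unfolding bead_jump_iff_rows using sr card outside step by auto
  then show "\<exists>s r. bead_jump k s r lam mu" by blast
qed


section \<open>Alternating functions of bead positions\<close>

text \<open>Only the first \<open>m\<close> entries count. The vanishing on colliding beads is a separate clause because it
  does not follow from the change of sign if 2 is not cancellable.\<close>

definition alternating :: "nat \<Rightarrow> ((nat \<Rightarrow> int) \<Rightarrow> 'r::comm_ring_1) \<Rightarrow> bool" where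
  "alternating m F \<longleftrightarrow>
     (\<forall>c c'. (\<forall>i<m. c i = c' i) \<longrightarrow> F c = F c') \<and>
     (\<forall>c r s. r < m \<longrightarrow> s < m \<longrightarrow> r \<noteq> s \<longrightarrow>
        F (c(r := c s, s := c r)) = - F c \<and> (c r = c s \<longrightarrow> F c = 0))"

lemma alternatingI:
  assumes "\<And>c c'. (\<And>i. i < m \<Longrightarrow> c i = c' i) \<Longrightarrow> F c = F c'"
    and "\<And>c r s. r < m \<Longrightarrow> s < m \<Longrightarrow> r \<noteq> s \<Longrightarrow> F (c(r := c s, s := c r)) = - F c"
    and "\<And>c r s. r < m \<Longrightarrow> s < m \<Longrightarrow> r \<noteq> s \<Longrightarrow> c r = c s \<Longrightarrow> F c = 0"
  shows "alternating m F"
  unfolding alternating_def using assms by blast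

lemma alternating_cong: "alternating m F \<Longrightarrow> (\<And>i. i < m \<Longrightarrow> c i = c' i) \<Longrightarrow> F c = F c'"
  unfolding alternating_def by blast

lemma alternating_swap:
  "alternating m F \<Longrightarrow> r < m \<Longrightarrow> s < m \<Longrightarrow> r \<noteq> s \<Longrightarrow> F (c(r := c s, s := c r)) = - F c"
  unfolding alternating_def by blast

lemma alternating_collision:
  "alternating m F \<Longrightarrow> r < m \<Longrightarrow> s < m \<Longrightarrow> r \<noteq> s \<Longrightarrow> c r = c s \<Longrightarrow> F c = 0"
  unfolding alternating_def by blast

lemma alternating_diff:
  assumes F: "alternating m F" and G: "alternating m G"
  shows "alternating m (\<lambda>c. a * F c - G c)"
proof (rule alternatingI)
  fix c c' :: "nat \<Rightarrow> int" assume eq: "\<And>i. i < m \<Longrightarrow> c i = c' i"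
  have "F c = F c'" by (rule alternating_cong[OF F]) (rule eq)
  moreover have "G c = G c'" by (rule alternating_cong[OF G]) (rule eq)
  ultimately show "a * F c - G c = a * F c' - G c'" by (simp only:)
next
  fix c :: "nat \<Rightarrow> int" and r s assume "r < m" "s < m" "r \<noteq> s"
  then show "a * F (c(r := c s, s := c r)) - G (c(r := c s, s := c r)) = - (a * F c - G c)"
    by (simp add: alternating_swap[OF F] alternating_swap[OF G])
next
  fix c :: "nat \<Rightarrow> int" and r s assume rs: "r < m" "s < m" "r \<noteq> s" "c r = c s"
  show "a * F c - G c = 0"
    by (simp add: alternating_collision[of m F r s c, OF F rs] alternating_collision[of m G r s c, OF G rs])
qed

text \<open>Moving every single bead by \<open>d\<close> and summing up commutes with exchanging two beads.\<close>

lemma alternating_sum_shifts: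
  assumes F: "alternating m F"
  shows "alternating m (\<lambda>c. \<Sum>s<m. F (c(s := c s + d)))"
proof (rule alternatingI)
  fix c c' :: "nat \<Rightarrow> int" assume "\<And>i. i < m \<Longrightarrow> c i = c' i"
  then show "(\<Sum>s<m. F (c(s := c s + d))) = (\<Sum>s<m. F (c'(s := c' s + d)))"
    by (intro sum.cong refl alternating_cong[OF F]) auto
next
  fix c :: "nat \<Rightarrow> int" and p q assume pq: "p < m" "q < m" "p \<noteq> q"
  let ?c = "c(p := c q, q := c p)"
  let ?t = "\<lambda>s. if s = p then q else if s = q then p else s"
  have "(\<Sum>s<m. F (?c(s := ?c s + d))) = (\<Sum>s<m. - F (c(?t s := c (?t s) + d)))"
  proof (intro sum.cong refl)
    fix s
    let ?e = "c(?t s := c (?t s) + d)"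
    have "?c(s := ?c s + d) = ?e(p := ?e q, q := ?e p)" using pq by auto
    then show "F (?c(s := ?c s + d)) = - F ?e" by (simp only: alternating_swap[OF F pq])
  qed
  also have "\<dots> = (\<Sum>s<m. - F (c(s := c s + d)))"
    by (rule sum.reindex_bij_witness[of _ ?t ?t]) (use pq in auto)
  finally show "(\<Sum>s<m. F (?c(s := ?c s + d))) = - (\<Sum>s<m. F (c(s := c s + d)))"
    by (simp add: sum_negf)
next
  fix c :: "nat \<Rightarrow> int" and p q assume pq: "p < m" "q < m" "p \<noteq> q" and eq: "c p = c q"
  let ?f = "\<lambda>s. F (c(s := c s + d))"
  have "?f s = 0" if "s \<in> {..<m} - {p, q}" for s
    using that pq eq by (intro alternating_collision[OF F, of p q]) auto
  then have "(\<Sum>s<m. ?f s) = (\<Sum>s\<in>{p, q}. ?f s)"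
    using pq by (intro sum.mono_neutral_right) auto
  then have sum: "(\<Sum>s<m. ?f s) = ?f p + ?f q" using pq by simp
  have "c(p := c p + d) = (c(q := c q + d))(p := (c(q := c q + d)) q, q := (c(q := c q + d)) p)"
    using pq eq by auto
  then have "?f p = - ?f q" by (metis alternating_swap[OF F pq])
  then show "(\<Sum>s<m. ?f s) = 0" using sum by simp
qed

text \<open>Positions at and below \<open>- m\<close> lie off the board: no partition with at most \<open>m\<close> rows has one of its
  first \<open>m\<close> beads there.\<close>

definition on_board :: "nat \<Rightarrow> ((nat \<Rightarrow> int) \<Rightarrow> 'r::comm_ring_1) \<Rightarrow> (nat \<Rightarrow> int) \<Rightarrow> 'r" where
  "on_board m F c = (if \<exists>i<m. c i \<le> - int m then 0 else F c)"

lemma alternating_on_board: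
  assumes F: "alternating m F"
  shows "alternating m (on_board m F)"
proof (rule alternatingI)
  fix c c' :: "nat \<Rightarrow> int" assume eq: "\<And>i. i < m \<Longrightarrow> c i = c' i"
  then have "(\<exists>i<m. c i \<le> - int m) \<longleftrightarrow> (\<exists>i<m. c' i \<le> - int m)" by auto
  moreover have "F c = F c'" by (rule alternating_cong[OF F]) (rule eq)
  ultimately show "on_board m F c = on_board m F c'" unfolding on_board_def by argo
next
  fix c :: "nat \<Rightarrow> int" and r s assume rs: "r < m" "s < m" "r \<noteq> s"
  have "(\<exists>i<m. (c(r := c s, s := c r)) i \<le> - int m) \<longleftrightarrow> (\<exists>i<m. c i \<le> - int m)" (is "?L \<longleftrightarrow> ?R")
  proof
    assume ?L
    then show ?R using rs by (metis fun_upd_apply)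
  next
    assume ?R
    then obtain i where "i < m" "c i \<le> - int m" by blast
    then have "(c(r := c s, s := c r)) (if i = r then s else if i = s then r else i) \<le> - int m"
      using rs by auto
    then show ?L
      using rs \<open>i < m\<close> by (intro exI[of _ "if i = r then s else if i = s then r else i"]) simp
  qed
  then show "on_board m F (c(r := c s, s := c r)) = - on_board m F c"
    by (simp only: on_board_def alternating_swap[OF F rs] if_distrib[of uminus] minus_zero)
qed (simp add: on_board_def alternating_collision[OF F])

text \<open>The rotation is a product of \<open>r - s\<close> exchanges of neighbours.\<close>

lemma alternating_slide:
  assumes "alternating m F" "s \<le> r" "r < m"
  shows "F (slide s r c) = (-1) ^ (r - s) * F c"
  using assms(2,3)
proof (induction r arbitrary: c rule: dec_induct)
  case base
  have "slide s s c = c" by (auto simp: slide_def)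
  then show ?case by simp
next
  case (step r)
  have eq: "slide s (Suc r) c = slide s r (c(r := c (Suc r), Suc r := c r))"
    using step.hyps by (auto simp: slide_def fun_eq_iff)
  have "F (slide s (Suc r) c) = (-1) ^ (r - s) * F (c(r := c (Suc r), Suc r := c r))"
    unfolding eq using step by simp
  also have "\<dots> = (-1) ^ (Suc r - s) * F c"
    using step by (simp add: alternating_swap[OF assms(1)] Suc_diff_le)
  finally show ?case .
qed

text \<open>The matrix has the row \<open>\<phi> (c i)\<close> in position \<open>i\<close>. Both the Jacobi-Trudi determinant and the
  coefficient functionals used below have this form.\<close>

definition row_det :: "nat \<Rightarrow> (int \<Rightarrow> nat \<Rightarrow> 'r::comm_ring_1) \<Rightarrow> (nat \<Rightarrow> int) \<Rightarrow> 'r" where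
  "row_det m \<phi> c = det (mat m m (\<lambda>(i, j). \<phi> (c i) j))"

lemma row_det_permutations:
  "row_det m \<phi> c = (\<Sum>p | p permutes {0..<m}. signof p * (\<Prod>i=0..<m. \<phi> (c i) (p i)))"
proof -
  have "row_det m \<phi> c = (\<Sum>p | p permutes {0..<m}.
      signof p * (\<Prod>i=0..<m. mat m m (\<lambda>(i, j). \<phi> (c i) j) $$ (i, p i)))"
    unfolding row_det_def by (rule det_def') simp
  also have "\<dots> = (\<Sum>p | p permutes {0..<m}. signof p * (\<Prod>i=0..<m. \<phi> (c i) (p i)))"
  proof (intro sum.cong arg_cong2[of _ _ _ _ "(*)"] prod.cong refl)
    fix p i assume "p \<in> {p. p permutes {0..<m}}" "i \<in> {0..<m}"
    then have "p i \<in> {0..<m}" by (simp only: permutes_in_image mem_Collect_eq)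
    then show "mat m m (\<lambda>(i, j). \<phi> (c i) j) $$ (i, p i) = \<phi> (c i) (p i)"
      using \<open>i \<in> {0..<m}\<close> by simp
  qed
  finally show ?thesis .
qed

lemma row_det_zero_row:
  assumes "r < m" "\<And>j. j < m \<Longrightarrow> \<phi> (c r) j = 0"
  shows "row_det m \<phi> c = 0"
proof -
  have "signof p * (\<Prod>i=0..<m. \<phi> (c i) (p i)) = 0" if "p permutes {0..<m}" for p
  proof -
    have "p r < m" using permutes_in_image[OF that, of r] assms(1) by simp
    then have "(\<Prod>i=0..<m. \<phi> (c i) (p i)) = 0"
      using assms by (intro prod_zero) (auto intro!: bexI[of _ r])
    then show ?thesis by simp
  qed
  then show ?thesis unfolding row_det_permutations by (intro sum.neutral) blast
qed

lemma alternating_row_det: "alternating m (row_det m \<phi>)"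
proof (rule alternatingI)
  fix c c' :: "nat \<Rightarrow> int" assume "\<And>i. i < m \<Longrightarrow> c i = c' i"
  then show "row_det m \<phi> c = row_det m \<phi> c'"
    unfolding row_det_def by (intro arg_cong[of _ _ det] eq_matI) auto
next
  fix c :: "nat \<Rightarrow> int" and r s assume rs: "r < m" "s < m" "r \<noteq> s"
  let ?A = "mat m m (\<lambda>(i, j). \<phi> (c i) j)"
  have "mat m m (\<lambda>(i, j). \<phi> ((c(r := c s, s := c r)) i) j) = swaprows r s ?A"
    using rs by (intro eq_matI) auto
  then show "row_det m \<phi> (c(r := c s, s := c r)) = - row_det m \<phi> c"
    unfolding row_det_def using det_swaprows[OF rs, of ?A] by simp
next
  fix c :: "nat \<Rightarrow> int" and r s assume rs: "r < m" "s < m" "r \<noteq> s" "c r = c s"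
  let ?A = "mat m m (\<lambda>(i, j). \<phi> (c i) j)"
  have "row ?A r = row ?A s" using rs by (intro eq_vecI) auto
  then show "row_det m \<phi> c = 0"
    unfolding row_det_def using rs det_identical_rows[of ?A m r s] by simp
qed

lemma tderiv_row_det:
  fixes \<phi> :: "int \<Rightarrow> nat \<Rightarrow> 'a::comm_ring_1 tpoly"
  assumes "\<And>x l. tderiv j (\<phi> x l) = \<phi> (x - d) l"
  shows "tderiv j (row_det m \<phi> c) = (\<Sum>r<m. row_det m \<phi> (c(r := c r - d)))"
proof -
  have sign: "tderiv j (signof p * f) = signof p * tderiv j f" for p and f :: "'a tpoly"
    by (simp add: sign_def tderiv_uminus)
  have "tderiv j (row_det m \<phi> c) = (\<Sum>p | p permutes {0..<m}. signof p *
      (\<Sum>r\<in>{0..<m}. \<Prod>i=0..<m. if i = r then tderiv j (\<phi> (c i) (p i)) else \<phi> (c i) (p i)))"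
    by (simp only: row_det_permutations tderiv_sum sign tderiv_prod[OF finite_atLeastLessThan])
  also have "\<dots> = (\<Sum>p | p permutes {0..<m}. signof p *
      (\<Sum>r\<in>{0..<m}. \<Prod>i=0..<m. \<phi> ((c(r := c r - d)) i) (p i)))"
    by (intro sum.cong arg_cong2[of _ _ _ _ "(*)"] prod.cong refl) (auto simp: assms)
  also have "\<dots> = (\<Sum>r\<in>{0..<m}. row_det m \<phi> (c(r := c r - d)))"
    unfolding row_det_permutations sum_distrib_left by (rule sum.swap)
  finally show ?thesis by (simp only: atLeast0LessThan)
qed


section \<open>Summing an alternating function over border strips\<close>

lemma sum_over_matching:
  assumes "\<And>a. a \<in> A \<Longrightarrow> \<exists>!b. b \<in> B \<and> P a b"
    and "\<And>b. b \<in> B \<Longrightarrow> \<exists>!a. a \<in> A \<and> P a b"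
    and eq: "\<And>a b. a \<in> A \<Longrightarrow> b \<in> B \<Longrightarrow> P a b \<Longrightarrow> f a = g b"
  shows "sum f A = sum g B"
proof -
  define h where "h a = (THE b. b \<in> B \<and> P a b)" for a
  have h: "h a \<in> B \<and> P a (h a)" if "a \<in> A" for a
    unfolding h_def by (rule theI') (use assms(1) that in blast)
  have "bij_betw h A B"
  proof (rule bij_betwI')
    fix a a' assume "a \<in> A" "a' \<in> A"
    then show "(h a = h a') = (a = a')" using h assms(2) by metis
  next
    fix b assume b: "b \<in> B"
    then obtain a where a: "a \<in> A" "P a b" using assms(2) by blast
    then have "b = h a" using h assms(1) b by blast
    then show "\<exists>a\<in>A. b = h a" using a by blast
  qed (use h in blast)
  then have "(\<Sum>a\<in>A. g (h a)) = sum g B" by (rule sum.reindex_bij_betw)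
  moreover have "sum f A = (\<Sum>a\<in>A. g (h a))" using h eq by (intro sum.cong) auto
  ultimately show ?thesis by simp
qed

lemma bead_jump_inner_row:
  assumes "bead_jump k s r lam mu" "s \<le> i" "i < r"
  shows "mu (Suc i) = Suc (lam i)"
proof -
  have "\<forall>i. s < i \<and> i \<le> r \<longrightarrow> mu i = Suc (lam (i - 1))"
    using assms(1) unfolding bead_jump_iff_rows by blast
  from this[rule_format, of "Suc i"] show ?thesis using assms by simp
qed

lemma border_strip_partitions:
  assumes "border_strip k mu lam"
  shows "is_partition mu" "is_partition lam"
  using assms by (simp_all add: border_strip_def)

lemma bead_jump_unique_ends:
  assumes "bead_jump k s r lam mu" "bead_jump k s' r' lam mu"
    and "k \<ge> 1" "is_partition lam" "is_partition mu"
  shows "s = s'" "r = r'"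
proof -
  have "{s..r} = {s'..r'}"
    using bead_jump_row_less_iff[OF assms(1,3-)] bead_jump_row_less_iff[OF assms(2,3-)]
    by (auto simp: set_eq_iff)
  moreover have "s \<le> r" using assms(1) by (simp add: bead_jump_def)
  ultimately show "s = s'" "r = r'" by (auto simp: Icc_eq_Icc)
qed

text \<open>The index \<open>s\<close> of the moved bead is determined by its new position, because beads are numbered
  from the highest to the lowest.\<close>

lemma bead_jump_unique_outer:
  assumes "bead_jump k s r lam mu" "bead_jump k s' r lam mu'" "is_partition mu" "is_partition mu'"
  shows "mu = mu'"
proof -
  have no: False
    if j: "bead_jump k s r lam mu" "bead_jump k s' r lam mu'" and "s < s'"
      and p: "is_partition mu" "is_partition mu'" for s s' mu mu'
  proof -
    have "mu (Suc s) = Suc (lam s)" "s' \<le> r" "s \<le> r"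
      using j \<open>s < s'\<close> unfolding bead_jump_iff_rows by auto
    moreover have "mu' s = lam s" using j(2) \<open>s < s'\<close> unfolding bead_jump_iff_rows by blast
    moreover have "int (mu s) - int s = int (mu' s') - int s'"
      using j unfolding bead_jump_iff_rows by (auto simp: of_nat_diff)
    moreover have "mu (Suc s) \<le> mu s" "mu' s' \<le> mu' s"
      using p \<open>s < s'\<close> by (auto intro: is_partition_antimono)
    ultimately show False using \<open>s < s'\<close> by linarith
  qed
  have "s = s'"
    using no[of s mu s' mu'] no[of s' mu' s mu] assms by (cases s s' rule: linorder_cases) auto
  then have "beads mu = beads mu'" using assms(1,2) by (simp add: bead_jump_def)
  then show ?thesis by (simp add: beads_eq_iff)
qed

lemma bead_jump_unique_inner:
  assumes "bead_jump k s r lam mu" "bead_jump k s r' lam' mu" "is_partition lam" "is_partition lam'"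
  shows "lam = lam'"
proof -
  have no: False
    if j: "bead_jump k s r lam mu" "bead_jump k s r' lam' mu" and "r < r'"
      and p: "is_partition lam" "is_partition lam'" for r r' lam lam'
  proof -
    have "s \<le> r" using j(1) by (simp add: bead_jump_def)
    have "mu (Suc r) = Suc (lam' r)"
      using j(2) \<open>r < r'\<close> \<open>s \<le> r\<close> unfolding bead_jump_iff_rows by auto
    moreover have "mu (Suc r) = lam (Suc r)" using j(1) unfolding bead_jump_iff_rows by blast
    moreover have "int (lam r) - int r = int (lam' r') - int r'"
      using j unfolding bead_jump_iff_rows by (auto simp: of_nat_diff)
    moreover have "lam (Suc r) \<le> lam r" "lam' r' \<le> lam' r"
      using p \<open>r < r'\<close> by (auto intro: is_partition_antimono)
    ultimately show False using \<open>r < r'\<close> by linarith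
  qed
  have r: "r = r'"
    using no[of r lam r' lam'] no[of r' lam' r lam] assms by (cases r r' rule: linorder_cases) auto
  show ?thesis
  proof
    fix i
    consider "i < s \<or> r < i" | "s \<le> i" "i < r" | "i = r" by linarith
    then show "lam i = lam' i"
    proof cases
      case 1
      then show ?thesis using assms(1,2) r unfolding bead_jump_iff_rows by metis
    next
      case 2
      then have "mu (Suc i) = Suc (lam i)" "mu (Suc i) = Suc (lam' i)"
        using assms(1,2) r bead_jump_inner_row by blast+
      then show ?thesis by simp
    next
      case 3
      then show ?thesis using assms(1,2) r unfolding bead_jump_iff_rows by auto
    qed
  qed
qed

text \<open>The bead is inserted before the first bead that lies below its new position. The resulting
  sequence is again strictly decreasing, so it comes from a partition.\<close>

lemma bead_jump_up_exists:
  assumes lam: "is_partition lam" and k: "k \<ge> 1"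
    and free: "beads lam r + int k \<notin> range (beads lam)"
  shows "\<exists>s mu. is_partition mu \<and> bead_jump k s r lam mu"
proof -
  let ?b = "beads lam"
  define y where "y = ?b r + int k"
  define s where "s = (LEAST i. ?b i < y)"
  have ry: "?b r < y" using k by (simp add: y_def)
  then have sr: "s \<le> r" unfolding s_def by (rule Least_le)
  have sy: "?b s < y" unfolding s_def using ry by (rule LeastI)
  have above: "y < ?b i" if "i < s" for i
  proof -
    have "\<not> ?b i < y" using not_less_Least[of i "\<lambda>i. ?b i < y"] that by (simp add: s_def)
    moreover have "?b i \<noteq> y" using free by (metis rangeI y_def)
    ultimately show ?thesis by simp
  qed
  have dec: "?b j < ?b i" if "i < j" for i j using beads_less[OF lam that] .
  define c where "c = slide s r (?b(r := y))"
  have c_lt: "c i = ?b i" if "i < s" for i using that sr by (simp add: c_def slide_def)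
  have c_s: "c s = y" by (simp add: c_def slide_def)
  have c_mid: "c i = ?b (i - 1)" if "s < i" "i \<le> r" for i using that by (auto simp: c_def slide_def)
  have c_gt: "c i = ?b i" if "r < i" for i using that sr by (simp add: c_def slide_def)
  have "c (Suc i) < c i" for i
  proof -
    consider "Suc i < s" | "Suc i = s" | "i = s" "s < r" | "i = s" "s = r" | "s < i" "i < r"
      | "s < i" "i = r" | "r < i"
      using sr by linarith
    then show ?thesis
    proof cases
      case 1
      then show ?thesis by (simp add: c_lt dec)
    next
      case 2
      then show ?thesis using above[of i] c_s c_lt[of i] by simp
    next
      case 3
      then show ?thesis using c_mid[of "Suc i"] c_s sy by simp
    next
      case 4
      then show ?thesis using c_gt[of "Suc r"] c_s ry dec[of r "Suc r"] by simp
    next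
      case 5
      then show ?thesis by (simp add: c_mid dec)
    next
      case 6
      then show ?thesis using dec[of "r - 1" "Suc r"] by (simp add: c_mid c_gt)
    next
      case 7
      then show ?thesis by (simp add: c_gt dec)
    qed
  qed
  moreover have "c i = - int i" if "max (nrows lam) (Suc r) \<le> i" for i
    using that beads_beyond[OF lam, of i] by (simp add: c_gt)
  ultimately obtain mu where "is_partition mu" "beads mu = c"
    using beads_surj by blast
  then show ?thesis using sr by (auto simp: bead_jump_def c_def y_def)
qed

lemma bead_jump_down_exists:
  assumes lam: "is_partition lam" and k: "k \<ge> 1"
    and free: "beads lam s - int k \<notin> range (beads lam)"
  shows "\<exists>r mu. is_partition mu \<and> bead_jump k s r mu lam"
proof -
  let ?b = "beads lam"
  define y where "y = ?b s - int k"
  define t where "t = (LEAST i. ?b i < y)"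
  have sy: "y < ?b s" using k by (simp add: y_def)
  have dec: "?b j < ?b i" if "i < j" for i j using beads_less[OF lam that] .
  have "?b (max (nrows lam) (nat (1 - y))) < y"
    by (simp add: beads_beyond[OF lam])
  then have ty: "?b t < y" unfolding t_def by (rule LeastI)
  have above: "y < ?b i" if "i < t" for i
  proof -
    have "\<not> ?b i < y" using not_less_Least[of i "\<lambda>i. ?b i < y"] that by (simp add: t_def)
    moreover have "?b i \<noteq> y" using free by (metis rangeI y_def)
    ultimately show ?thesis by simp
  qed
  have "s < t"
  proof (rule ccontr)
    assume "\<not> s < t"
    then have "?b s \<le> ?b t" using dec[of t s] by (cases "t = s") auto
    then show False using sy ty by simp
  qed
  then obtain r where t: "t = Suc r" and sr: "s \<le> r" by (cases t) auto
  define c where "c = (\<lambda>i. if s \<le> i \<and> i < r then ?b (Suc i) else if i = r then y else ?b i)"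
  have "c (Suc i) < c i" for i
  proof -
    consider "Suc i < s" | "Suc i = s" | "s \<le> i" "Suc i < r" | "s \<le> i" "Suc i = r" | "i = r" | "r < i"
      using sr by linarith
    then show ?thesis
    proof cases
      case 1
      then show ?thesis using sr by (simp add: c_def dec)
    next
      case 2
      then show ?thesis using sr dec[of i "Suc s"] dec[of i s] sy by (auto simp: c_def)
    next
      case 3
      then show ?thesis by (simp add: c_def dec)
    next
      case 4
      then show ?thesis using above[of r] t by (simp add: c_def)
    next
      case 5
      then show ?thesis using ty t by (simp add: c_def)
    next
      case 6
      then show ?thesis by (simp add: c_def dec)
    qed
  qed
  moreover have "c i = - int i" if "max (nrows lam) (Suc r) \<le> i" for i
    using that beads_beyond[OF lam, of i] by (simp add: c_def)
  ultimately obtain mu where mu: "is_partition mu" "beads mu = c"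
    using beads_surj by blast
  have "?b = slide s r (c(r := c r + int k))"
  proof
    fix i
    show "?b i = slide s r (c(r := c r + int k)) i"
      using sr by (cases i) (auto simp: slide_def c_def y_def)
  qed
  then show ?thesis using mu sr by (auto simp: bead_jump_def)
qed

lemma bead_jump_up_alternating:
  assumes F: "alternating m F" and jump: "bead_jump k s r lam mu" and r: "r < m"
  shows "F ((beads lam)(r := beads lam r + int k)) = (-1) ^ (r - s) * F (beads mu)"
proof -
  have "F (beads mu) = (-1) ^ (r - s) * F ((beads lam)(r := beads lam r + int k))"
    using jump alternating_slide[OF F _ r] by (simp add: bead_jump_def)
  then show ?thesis by (simp add: power_mult_distrib[symmetric] mult.assoc[symmetric])
qed

lemma bead_jump_down_alternating:
  assumes F: "alternating m F" and jump: "bead_jump k s r lam mu" and r: "r < m"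
  shows "F ((beads mu)(s := beads mu s - int k)) = (-1) ^ (r - s) * F (beads lam)"
proof -
  have "(beads mu)(s := beads mu s - int k) = slide s r (beads lam)"
    using jump by (auto simp: bead_jump_def slide_def fun_eq_iff)
  then show ?thesis
    using jump alternating_slide[OF F _ r] by (simp add: bead_jump_def)
qed

text \<open>If the landing position were occupied, the partition after the jump would have two beads in the
  same place.\<close>

lemma bead_jump_lands_free:
  assumes jump: "bead_jump k s r lam mu" and k: "k \<ge> 1"
    and lam: "is_partition lam" and mu: "is_partition mu"
  shows "beads lam r + int k \<notin> range (beads lam)" and "beads mu s - int k \<notin> range (beads mu)"
proof -
  have sr: "s \<le> r" and eq: "beads mu = slide s r ((beads lam)(r := beads lam r + int k))"
    using jump by (auto simp: bead_jump_def)
  have s: "beads mu s = beads lam r + int k" by (simp add: eq slide_def)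
  show "beads lam r + int k \<notin> range (beads lam)"
  proof
    assume "beads lam r + int k \<in> range (beads lam)"
    then obtain i where i: "beads lam r + int k = beads lam i" by auto
    have ir: "i \<noteq> r" using i k by auto
    define j where "j = (if s \<le> i \<and> i < r then Suc i else i)"
    have "beads mu j = beads lam i" "j \<noteq> s" using sr ir by (auto simp: eq slide_def j_def)
    then show False using beads_inj[OF mu, of j s] s i by simp
  qed
  show "beads mu s - int k \<notin> range (beads mu)"
  proof
    assume "beads mu s - int k \<in> range (beads mu)"
    then obtain i where i: "beads mu s - int k = beads mu i" by auto
    have "i \<noteq> s" using i k by auto
    define j where "j = (if s < i \<and> i \<le> r then i - 1 else i)"
    have "beads lam j = beads mu i" "j \<noteq> r" using sr \<open>i \<noteq> s\<close> by (auto simp: eq slide_def j_def)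
    then show False using beads_inj[OF lam, of j r] s i by simp
  qed
qed

text \<open>Move each bead up by \<open>k\<close> in turn. A bead that lands on another one contributes 0, and the other
  moves are the ways to add a border strip. Since the \<open>k\<close> last of the \<open>m\<close> beads belong to empty rows,
  no bead with index at least \<open>m\<close> can move to a free position.\<close>

lemma sum_add_border_strips:
  assumes F: "alternating m F" and lam: "is_partition lam" and k: "k \<ge> 1" and m: "nrows lam + k \<le> m"
  shows "(\<Sum>r<m. F ((beads lam)(r := beads lam r + int k))) =
    (\<Sum>mu | border_strip k mu lam. (-1) ^ ht (skew mu lam) * F (beads mu))"
proof -
  let ?b = "beads lam"
  let ?A = "{r. r < m \<and> ?b r + int k \<notin> range ?b}"
  have "(\<Sum>r<m. F (?b(r := ?b r + int k))) = (\<Sum>r\<in>?A. F (?b(r := ?b r + int k)))"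
  proof (rule sum.mono_neutral_right)
    show "\<forall>r\<in>{..<m} - ?A. F (?b(r := ?b r + int k)) = 0"
    proof
      fix r assume r: "r \<in> {..<m} - ?A"
      then obtain i where i: "?b i = ?b r + int k" by auto
      have "i < r"
        using beads_less[OF lam, of r i] i k by (cases i r rule: linorder_cases) auto
      then show "F (?b(r := ?b r + int k)) = 0"
        using r i by (intro alternating_collision[OF F, of r i]) auto
    qed
  qed auto
  also have "\<dots> = (\<Sum>mu | border_strip k mu lam. (-1) ^ ht (skew mu lam) * F (beads mu))"
  proof (rule sum_over_matching[where P = "\<lambda>r mu. \<exists>s. bead_jump k s r lam mu"])
    fix r assume "r \<in> ?A"
    then obtain s mu where mu: "is_partition mu" "bead_jump k s r lam mu"
      using bead_jump_up_exists[OF lam k] by blast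
    show "\<exists>!mu. mu \<in> {mu. border_strip k mu lam} \<and> (\<exists>s. bead_jump k s r lam mu)"
    proof (rule ex1I[of _ mu])
      show "mu \<in> {mu. border_strip k mu lam} \<and> (\<exists>s. bead_jump k s r lam mu)"
        using bead_jump_border_strip(1)[OF mu(2) k lam mu(1)] mu by blast
    next
      fix mu' assume "mu' \<in> {mu. border_strip k mu lam} \<and> (\<exists>s. bead_jump k s r lam mu')"
      then obtain s' where j: "border_strip k mu' lam" "bead_jump k s' r lam mu'" by blast
      show "mu' = mu"
        by (rule bead_jump_unique_outer[OF j(2) mu(2) border_strip_partitions(1)[OF j(1)] mu(1)])
    qed
  next
    fix mu assume "mu \<in> {mu. border_strip k mu lam}"
    then have strip: "border_strip k mu lam" by simp
    then have mu: "is_partition mu" by (simp add: border_strip_def)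
    obtain s r where jump: "bead_jump k s r lam mu" using border_strip_bead_jump[OF strip] by blast
    have free: "?b r + int k \<notin> range ?b" by (rule bead_jump_lands_free[OF jump k lam mu])
    have "r < m"
    proof (rule ccontr)
      assume "\<not> r < m"
      then have "?b (r - k) = ?b r + int k"
        using m beads_beyond[OF lam, of r] beads_beyond[OF lam, of "r - k"] by (simp add: of_nat_diff)
      then show False using free by (metis rangeI)
    qed
    then show "\<exists>!r. r \<in> ?A \<and> (\<exists>s. bead_jump k s r lam mu)"
      using free jump bead_jump_unique_ends(2)[OF _ jump k lam mu] by blast
  next
    fix r mu assume r: "r \<in> ?A" and "mu \<in> {mu. border_strip k mu lam}" and "\<exists>s. bead_jump k s r lam mu"
    then obtain s where jump: "bead_jump k s r lam mu" and mu: "is_partition mu"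
      by (auto simp: border_strip_def)
    show "F (?b(r := ?b r + int k)) = (-1) ^ ht (skew mu lam) * F (beads mu)"
      using bead_jump_up_alternating[OF F jump] r bead_jump_border_strip(2)[OF jump k lam mu] by simp
  qed
  finally show ?thesis .
qed

text \<open>Downwards, a bead may also fall off the end of the board, to a position at most \<open>- m\<close>; there
  the function is required to vanish.\<close>

lemma sum_remove_border_strips:
  assumes F: "alternating m F" and lam: "is_partition lam" and k: "k \<ge> 1" and m: "nrows lam \<le> m"
    and vanish: "\<And>c r. r < m \<Longrightarrow> c r \<le> - int m \<Longrightarrow> F c = 0"
  shows "(\<Sum>s<m. F ((beads lam)(s := beads lam s - int k))) =
    (\<Sum>mu | border_strip k lam mu. (-1) ^ ht (skew lam mu) * F (beads mu))"
proof -
  let ?b = "beads lam"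
  let ?A = "{s. s < m \<and> ?b s - int k \<notin> range ?b \<and> - int m < ?b s - int k}"
  have "(\<Sum>s<m. F (?b(s := ?b s - int k))) = (\<Sum>s\<in>?A. F (?b(s := ?b s - int k)))"
  proof (rule sum.mono_neutral_right)
    show "\<forall>s\<in>{..<m} - ?A. F (?b(s := ?b s - int k)) = 0"
    proof
      fix s assume s: "s \<in> {..<m} - ?A"
      show "F (?b(s := ?b s - int k)) = 0"
      proof (cases "?b s - int k \<le> - int m")
        case True
        then show ?thesis using s by (intro vanish[of s]) auto
      next
        case False
        then obtain i where i: "?b i = ?b s - int k" using s by auto
        have "i < m"
          using beads_beyond[OF lam, of i] i False m by (cases "i < m") auto
        moreover have "i \<noteq> s" using i k by auto
        ultimately show ?thesis
          using s i by (intro alternating_collision[OF F, of s i]) auto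
      qed
    qed
  qed auto
  also have "\<dots> = (\<Sum>mu | border_strip k lam mu. (-1) ^ ht (skew lam mu) * F (beads mu))"
  proof (rule sum_over_matching[where P = "\<lambda>s mu. \<exists>r. bead_jump k s r mu lam"])
    fix s assume "s \<in> ?A"
    then obtain r mu where mu: "is_partition mu" "bead_jump k s r mu lam"
      using bead_jump_down_exists[OF lam k] by blast
    show "\<exists>!mu. mu \<in> {mu. border_strip k lam mu} \<and> (\<exists>r. bead_jump k s r mu lam)"
    proof (rule ex1I[of _ mu])
      show "mu \<in> {mu. border_strip k lam mu} \<and> (\<exists>r. bead_jump k s r mu lam)"
        using bead_jump_border_strip(1)[OF mu(2) k mu(1) lam] mu by blast
    next
      fix mu' assume "mu' \<in> {mu. border_strip k lam mu} \<and> (\<exists>r. bead_jump k s r mu' lam)"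
      then obtain r' where j: "border_strip k lam mu'" "bead_jump k s r' mu' lam" by blast
      show "mu' = mu"
        by (rule bead_jump_unique_inner[OF j(2) mu(2) border_strip_partitions(2)[OF j(1)] mu(1)])
    qed
  next
    fix mu assume "mu \<in> {mu. border_strip k lam mu}"
    then have strip: "border_strip k lam mu" by simp
    then have mu: "is_partition mu" by (simp add: border_strip_def)
    obtain s r where jump: "bead_jump k s r mu lam" using border_strip_bead_jump[OF strip] by blast
    have sr: "s \<le> r" using jump by (simp add: bead_jump_def)
    have "lam r \<noteq> 0" using bead_jump_row_less_iff[OF jump k mu lam, of r] sr by auto
    then have "r \<in> {r. lam r \<noteq> 0}" by simp
    then have "r < m" unfolding nonzero_rows[OF lam] using m by simp
    have "?b s - int k = beads mu r" using jump by (simp add: bead_jump_def slide_def)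
    then have "- int m < ?b s - int k" using \<open>r < m\<close> by (simp add: beads_def)
    then have "s \<in> ?A" using bead_jump_lands_free(2)[OF jump k mu lam] \<open>r < m\<close> sr by simp
    then show "\<exists>!s. s \<in> ?A \<and> (\<exists>r. bead_jump k s r mu lam)"
      using jump bead_jump_unique_ends(1)[OF _ jump k mu lam] by blast
  next
    fix s mu assume s: "s \<in> ?A" and "mu \<in> {mu. border_strip k lam mu}" and "\<exists>r. bead_jump k s r mu lam"
    then obtain r where jump: "bead_jump k s r mu lam" and mu: "is_partition mu"
      by (auto simp: border_strip_def)
    have "lam r \<noteq> 0"
      using bead_jump_row_less_iff[OF jump k mu lam, of r] jump by (auto simp: bead_jump_def)
    then have "r \<in> {r. lam r \<noteq> 0}" by simp
    then have "r < m" unfolding nonzero_rows[OF lam] using m by simp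
    then show "F (?b(s := ?b s - int k)) = (-1) ^ ht (skew lam mu) * F (beads mu)"
      using bead_jump_down_alternating[OF F jump] bead_jump_border_strip(2)[OF jump k mu lam] by simp
  qed
  finally show ?thesis .
qed


section \<open>The Murnaghan-Nakayama rules\<close>

text \<open>The determinant that defines a Schur polynomial, with arbitrary integers \<open>c i\<close> in place of
  \<open>\<lambda>\<^sub>i - i\<close>. This makes it an alternating function of the positions \<open>c\<close>, and shifts of single positions
  make sense even where they do not lead to a partition.\<close>

definition jacobi_trudi :: "nat \<Rightarrow> (nat \<Rightarrow> int) \<Rightarrow> 'a::field_char_0 tpoly" where
  "jacobi_trudi m = row_det m (\<lambda>x j. elem_schur (x + int j))"

lemma jacobi_trudi_beads:
  assumes "is_partition lam" "nrows lam \<le> m"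
  shows "jacobi_trudi m (beads lam) = schur lam"
  using schur_det_eq_schur[OF assms] by (simp add: jacobi_trudi_def row_det_def schur_det_def beads_def)

lemma alternating_jacobi_trudi: "alternating m (jacobi_trudi m)"
  unfolding jacobi_trudi_def by (rule alternating_row_det)

lemma jacobi_trudi_off_board:
  assumes "r < m" "c r \<le> - int m"
  shows "jacobi_trudi m c = 0"
  unfolding jacobi_trudi_def using assms by (intro row_det_zero_row[of r]) (auto simp: elem_schur_def)

lemma tderiv_jacobi_trudi:
  assumes "j \<ge> 1"
  shows "tderiv j (jacobi_trudi m c :: 'a::field_char_0 tpoly) = (\<Sum>r<m. jacobi_trudi m (c(r := c r - int j)))"
  unfolding jacobi_trudi_def by (rule tderiv_row_det) (simp add: tderiv_elem_schur[OF assms] algebra_simps)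

lemma tderiv_0_jacobi_trudi: "tderiv 0 (jacobi_trudi m c :: 'a::field_char_0 tpoly) = 0"
proof -
  have sign: "tderiv 0 (signof p * f) = signof p * tderiv 0 f" for p and f :: "'a tpoly"
    by (simp add: sign_def tderiv_uminus)
  have "tderiv 0 (\<Prod>i=0..<m. elem_schur (c i + int (p i)) :: 'a tpoly) = 0" for p
    unfolding tderiv_prod[OF finite_atLeastLessThan] tderiv_0_elem_schur
    by (intro sum.neutral ballI prod_zero) (auto intro!: bexI)
  then show ?thesis
    by (simp add: jacobi_trudi_def row_det_permutations tderiv_sum sign)
qed

text \<open>At \<open>t = 0\<close> the elementary Schur polynomials other than \<open>s\<^sub>0 = 1\<close> vanish, so only permutations \<open>p\<close>
  with \<open>c i + p i = 0\<close> for all \<open>i\<close> contribute to the determinant. Summing over \<open>i\<close> shows that there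
  are none.\<close>

lemma lookup_0_jacobi_trudi:
  assumes "(\<Sum>i<m. c i + int i) \<noteq> 0"
  shows "Poly_Mapping.lookup (jacobi_trudi m c :: 'a::field_char_0 tpoly) 0 = 0"
proof -
  have "Poly_Mapping.lookup (signof p * (\<Prod>i=0..<m. elem_schur (c i + int (p i))) :: 'a tpoly) 0 = 0"
    if p: "p permutes {0..<m}" for p
  proof -
    have "\<exists>i<m. c i + int (p i) \<noteq> 0"
    proof (rule ccontr)
      assume "\<not> (\<exists>i<m. c i + int (p i) \<noteq> 0)"
      then have "(\<Sum>i<m. c i + int (p i)) = 0" by simp
      moreover have "(\<Sum>i<m. int (p i)) = (\<Sum>i<m. int i)"
        using sum.permute[OF p, of int] by (simp add: atLeast0LessThan comp_def)
      ultimately show False using assms by (simp add: sum.distrib)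
    qed
    then obtain i where "i < m" "c i + int (p i) \<noteq> 0" by blast
    then have "Poly_Mapping.lookup (\<Prod>i=0..<m. elem_schur (c i + int (p i)) :: 'a tpoly) 0 = 0"
      unfolding lookup_0_prod by (intro prod_zero) (auto simp: lookup_0_elem_schur intro!: bexI[of _ i])
    then show ?thesis by (simp add: lookup_0_mult)
  qed
  then show ?thesis
    unfolding jacobi_trudi_def row_det_permutations lookup_sum by (intro sum.neutral) blast
qed

lemma beads_above:
  assumes "i < m"
  shows "- int m < beads lam i"
  using assms by (simp add: beads_def)

lemma on_board_beads: "on_board m F (beads lam) = F (beads lam)"
proof -
  have "\<not> (\<exists>i<m. beads lam i \<le> - int m)" using beads_above[of _ m lam] by (auto simp: not_le)
  then show ?thesis by (simp only: on_board_def if_False)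
qed

lemma nrows_mono:
  assumes "is_partition lam" "is_partition mu" "diagram mu \<subseteq> diagram lam"
  shows "nrows mu \<le> nrows lam"
proof -
  have "{r. mu r \<noteq> 0} \<subseteq> {r. lam r \<noteq> 0}"
  proof
    fix r assume "r \<in> {r. mu r \<noteq> 0}"
    then have "(r, 0) \<in> diagram mu" by (simp add: diagram_def)
    then have "(r, 0) \<in> diagram lam" using assms(3) by blast
    then show "r \<in> {r. lam r \<noteq> 0}" by (simp add: diagram_def)
  qed
  then show ?thesis
    unfolding nonzero_rows[OF assms(1)] nonzero_rows[OF assms(2)] by simp
qed

lemma border_strip_nrows:
  assumes "border_strip k mu lam"
  shows "nrows lam \<le> nrows mu" "nrows mu \<le> nrows lam + k"
proof -
  note parts = border_strip_partitions[OF assms]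
  show "nrows lam \<le> nrows mu"
    using nrows_mono[OF parts] assms by (simp add: border_strip_def)
  have "(\<lambda>r. (r, 0)) ` {nrows lam..<nrows mu} \<subseteq> skew mu lam"
  proof
    fix x assume "x \<in> (\<lambda>r. (r, 0::nat)) ` {nrows lam..<nrows mu}"
    then obtain r where x: "x = (r, 0)" "nrows lam \<le> r" "r < nrows mu" by auto
    then have "r \<in> {r. mu r \<noteq> 0}" "r \<notin> {r. lam r \<noteq> 0}"
      unfolding nonzero_rows[OF parts(1)] nonzero_rows[OF parts(2)] by auto
    then show "x \<in> skew mu lam" using x by (simp add: skew_def diagram_def)
  qed
  moreover have "finite (skew mu lam)" using finite_diagram[OF parts(1)] by (simp add: skew_def)
  ultimately have "card ((\<lambda>r. (r, 0::nat)) ` {nrows lam..<nrows mu}) \<le> card (skew mu lam)"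
    by (rule card_mono[rotated])
  moreover have "card ((\<lambda>r. (r, 0::nat)) ` {nrows lam..<nrows mu}) = nrows mu - nrows lam"
    by (subst card_image) (auto simp: inj_on_def)
  moreover have "card (skew mu lam) = k" using assms by (simp add: border_strip_def)
  ultimately show "nrows mu \<le> nrows lam + k" by simp
qed

text \<open>The sum is over the beads that leave the board when they move down by \<open>j\<close>, and then move up by \<open>k\<close>.
  The beads of the empty rows fill the \<open>k\<close> lowest positions of the board. Hence for \<open>j \<noteq> k\<close> each of
  these beads either stays off the board or collides with another one. For \<open>j = k\<close> there are exactly
  \<open>k\<close> such beads, and each of them returns to its place.\<close>

lemma power_sum_times_jacobi_trudi_cut_off:
  assumes lam: "is_partition lam" and k: "k \<ge> 1" and m: "nrows lam + k \<le> m" and j: "j \<ge> 1"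
  shows "(\<Sum>s\<in>{s. s < m \<and> beads lam s - int j \<le> - int m}.
      jacobi_trudi m ((beads lam)(s := beads lam s + (int k - int j)))) =
    (if j = k then of_nat k * jacobi_trudi m (beads lam) else 0 :: 'a::field_char_0 tpoly)"
proof -
  let ?b = "beads lam"
  have low: "?b i = - int i" if "m - k \<le> i" for i
    using that m by (intro beads_beyond[OF lam]) simp
  show ?thesis
  proof (cases "j = k")
    case True
    have "{s. s < m \<and> ?b s - int j \<le> - int m} = {m - k..<m}"
    proof (rule subset_antisym; rule subsetI)
      fix s assume s: "s \<in> {s. s < m \<and> ?b s - int j \<le> - int m}"
      then have "?b s \<le> - int s + (int s - int (m - k))" using True m by (simp add: of_nat_diff)
      moreover have "\<not> s < m - k" using beads_less[OF lam, of s "m - k"] low[of "m - k"] calculation by auto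
      ultimately show "s \<in> {m - k..<m}" using s by simp
    next
      fix s assume "s \<in> {m - k..<m}"
      then show "s \<in> {s. s < m \<and> ?b s - int j \<le> - int m}"
        using low[of s] True m by auto
    qed
    then show ?thesis using True m by simp
  next
    case False
    have "jacobi_trudi m (?b(s := ?b s + (int k - int j))) = (0 :: 'a tpoly)"
      if s: "s < m" "?b s - int j \<le> - int m" for s
    proof (cases "?b s + (int k - int j) \<le> - int m")
      case True
      then show ?thesis using s by (intro jacobi_trudi_off_board[of s]) auto
    next
      case False
      define i where "i = nat (- (?b s + (int k - int j)))"
      have i: "int i = - (?b s + (int k - int j))" "i < m" "m - k \<le> i"
        using s False m by (auto simp: i_def)
      then have "?b i = ?b s + (int k - int j)" by (simp add: low)
      moreover from this have "i \<noteq> s" using \<open>j \<noteq> k\<close> by auto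
      ultimately show ?thesis
        using s i by (intro alternating_collision[OF alternating_jacobi_trudi, of s m i]) auto
    qed
    then have "(\<Sum>s\<in>{s. s < m \<and> ?b s - int j \<le> - int m}.
        jacobi_trudi m (?b(s := ?b s + (int k - int j)))) = (0 :: 'a tpoly)"
      by (intro sum.neutral) blast
    then show ?thesis using False by simp
  qed
qed

text \<open>The difference of the two sides has derivative 0 in every \<open>t\<^sub>j\<close>, so it is constant, and its
  constant term is 0. For the derivative, compare \<open>\<partial>\<^sub>j\<close> of the difference with the sum, over the
  partitions obtained by removing a strip of size \<open>j\<close>, of the same difference, which vanishes by
  induction. Moving one bead down by \<open>j\<close> and then another up by \<open>k\<close> is the same as doing this in the
  other order; what remains are the beads that pass below the end of the board, and they
  contribute exactly the term \<open>(\<partial>\<^sub>j (k t\<^sub>k)) s\<^sub>\<lambda>\<close>.\<close>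

lemma power_sum_times_jacobi_trudi:
  assumes "is_partition lam" and k: "k \<ge> 1" and "nrows lam + k \<le> m"
  shows "of_nat k * tvar k * jacobi_trudi m (beads lam) =
    (\<Sum>r<m. jacobi_trudi m ((beads lam)(r := beads lam r + int k)) :: 'a::field_char_0 tpoly)"
  using assms(1,3)
proof (induction "card (diagram lam)" arbitrary: lam rule: less_induct)
  case less
  note lam = less.prems(1) and m = less.prems(2)
  let ?b = "beads lam"
  define R :: "(nat \<Rightarrow> int) \<Rightarrow> 'a tpoly" where
    "R c = of_nat k * tvar k * jacobi_trudi m c - (\<Sum>r<m. jacobi_trudi m (c(r := c r + int k)))" for c
  have alt: "alternating m R"
    unfolding R_def by (intro alternating_diff alternating_sum_shifts alternating_jacobi_trudi)
  have d: "tderiv j (R ?b) = 0" for j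
  proof (cases "j = 0")
    case True
    then show ?thesis
      using k by (simp add: R_def tderiv_diff tderiv_mult tderiv_sum tderiv_tvar tderiv_0_jacobi_trudi)
  next
    case False
    then have j: "j \<ge> 1" by simp
    let ?low = "{s. s < m \<and> ?b s - int j \<le> - int m}"
    have "(\<Sum>s<m. on_board m R (?b(s := ?b s - int j))) =
        (\<Sum>nu | border_strip j lam nu. (-1) ^ ht (skew lam nu) * on_board m R (beads nu))"
    proof (rule sum_remove_border_strips[OF alternating_on_board[OF alt] lam j])
      show "on_board m R c = 0" if "r < m" "c r \<le> - int m" for c r
        using that by (auto simp: on_board_def)
    qed (use m in simp)
    also have "\<dots> = 0"
    proof (rule sum.neutral, rule ballI)
      fix nu assume "nu \<in> {nu. border_strip j lam nu}"
      then have nu: "border_strip j lam nu" by simp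
      then have "R (beads nu) = 0"
        using less.hyps[of nu] border_strip_card[OF nu] j border_strip_partitions[OF nu]
          border_strip_nrows[OF nu] m by (simp add: R_def)
      then show "(-1) ^ ht (skew lam nu) * on_board m R (beads nu) = 0" by (simp add: on_board_beads)
    qed
    finally have sum0: "(\<Sum>s<m. on_board m R (?b(s := ?b s - int j))) = 0" .
    have summand: "of_nat k * tvar k * jacobi_trudi m (?b(s := ?b s - int j)) -
        (\<Sum>r<m. jacobi_trudi m (?b(r := ?b r + int k, s := (?b(r := ?b r + int k)) s - int j))) =
      on_board m R (?b(s := ?b s - int j)) -
        (if s \<in> ?low then jacobi_trudi m (?b(s := ?b s + (int k - int j))) else 0)" if s: "s < m" for s
    proof (cases "s \<in> ?low")
      case True
      have "(\<Sum>r<m. jacobi_trudi m (?b(r := ?b r + int k, s := (?b(r := ?b r + int k)) s - int j))) =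
          (\<Sum>r<m. if r = s then jacobi_trudi m (?b(s := ?b s + (int k - int j))) else 0 :: 'a tpoly)"
      proof (intro sum.cong refl)
        fix r
        show "jacobi_trudi m (?b(r := ?b r + int k, s := (?b(r := ?b r + int k)) s - int j)) =
            (if r = s then jacobi_trudi m (?b(s := ?b s + (int k - int j))) else 0 :: 'a tpoly)"
        proof (cases "r = s")
          case False
          then show ?thesis using True by (simp, intro jacobi_trudi_off_board[of s]) auto
        qed (simp add: algebra_simps)
      qed
      moreover have "jacobi_trudi m (?b(s := ?b s - int j)) = (0 :: 'a tpoly)"
        using True by (intro jacobi_trudi_off_board[of s]) auto
      moreover have "on_board m R (?b(s := ?b s - int j)) = 0"
        using True unfolding on_board_def by auto
      ultimately show ?thesis using True s by simp
    next
      case False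
      have "\<not> (\<exists>i<m. (?b(s := ?b s - int j)) i \<le> - int m)"
        using False s beads_above[of _ m lam] by (auto simp: not_le)
      then have "on_board m R (?b(s := ?b s - int j)) = R (?b(s := ?b s - int j))"
        by (simp only: on_board_def if_False)
      moreover have "?b(r := ?b r + int k, s := (?b(r := ?b r + int k)) s - int j) =
          ?b(s := ?b s - int j, r := (?b(s := ?b s - int j)) r + int k)" for r
        by auto
      ultimately show ?thesis using False by (simp only: R_def if_False diff_zero)
    qed
    have "tderiv j (R ?b) = (if j = k then of_nat k else 0) * jacobi_trudi m ?b +
        (\<Sum>s<m. of_nat k * tvar k * jacobi_trudi m (?b(s := ?b s - int j))) -
        (\<Sum>r<m. \<Sum>s<m. jacobi_trudi m (?b(r := ?b r + int k, s := (?b(r := ?b r + int k)) s - int j)))"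
      by (simp add: R_def tderiv_diff tderiv_mult tderiv_sum tderiv_tvar tderiv_jacobi_trudi[OF j] sum_distrib_left)
    also have "\<dots> = (if j = k then of_nat k else 0) * jacobi_trudi m ?b +
        (\<Sum>s<m. of_nat k * tvar k * jacobi_trudi m (?b(s := ?b s - int j)) -
          (\<Sum>r<m. jacobi_trudi m (?b(r := ?b r + int k, s := (?b(r := ?b r + int k)) s - int j))))"
      unfolding sum_subtractf by (subst sum.swap) simp
    also have "\<dots> = (if j = k then of_nat k else 0) * jacobi_trudi m ?b +
        (\<Sum>s<m. on_board m R (?b(s := ?b s - int j)) -
          (if s \<in> ?low then jacobi_trudi m (?b(s := ?b s + (int k - int j))) else 0))"
      using summand by (intro arg_cong2[of _ _ _ _ "(+)"] sum.cong refl) (simp only: lessThan_iff)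
    also have "\<dots> = (if j = k then of_nat k else 0) * jacobi_trudi m ?b -
        (\<Sum>s<m. if s \<in> ?low then jacobi_trudi m (?b(s := ?b s + (int k - int j))) else 0)"
      unfolding sum_subtractf sum0 by simp
    also have "(\<Sum>s<m. if s \<in> ?low then jacobi_trudi m (?b(s := ?b s + (int k - int j))) else 0) =
        (\<Sum>s\<in>?low. jacobi_trudi m (?b(s := ?b s + (int k - int j))) :: 'a tpoly)"
      by (rule sum.mono_neutral_cong_right) auto
    also have "\<dots> = (if j = k then of_nat k * jacobi_trudi m ?b else 0)"
      by (rule power_sum_times_jacobi_trudi_cut_off[OF lam k m j])
    finally show ?thesis by simp
  qed
  have "Poly_Mapping.lookup (tvar k :: 'a tpoly) 0 = 0"
    by (auto simp: tvar_def lookup_single when_def poly_mapping_eq_iff fun_eq_iff)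
  moreover have "Poly_Mapping.lookup (jacobi_trudi m (?b(r := ?b r + int k)) :: 'a tpoly) 0 = 0" if "r < m" for r
  proof (rule lookup_0_jacobi_trudi)
    have "(\<Sum>i<m. (?b(r := ?b r + int k)) i + int i) = (\<Sum>i<m. int (lam i) + (if i = r then int k else 0))"
      by (intro sum.cong refl) (auto simp: beads_def)
    also have "\<dots> = (\<Sum>i<m. int (lam i)) + int k" using that by (simp add: sum.distrib)
    also have "\<dots> > 0" using k by (simp add: add_nonneg_pos sum_nonneg)
    finally show "(\<Sum>i<m. (?b(r := ?b r + int k)) i + int i) \<noteq> 0" by simp
  qed
  ultimately have "Poly_Mapping.lookup (R ?b) 0 = 0"
    by (simp add: R_def lookup_minus lookup_0_mult lookup_sum)
  then have "R ?b = 0" using constant_if_tderivs_zero[OF d] by (simp add: Const_simps)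
  then show ?case by (simp add: R_def)
qed

lemma murnaghan_nakayama_mult:
  assumes lam: "is_partition lam" and k: "k \<ge> 1"
  shows "of_nat k * tvar k * schur lam =
    (\<Sum>mu | border_strip k mu lam. (-1) ^ ht (skew mu lam) * schur mu :: 'a::field_char_0 tpoly)"
proof -
  define m where "m = nrows lam + k"
  have "of_nat k * tvar k * schur lam = of_nat k * tvar k * (jacobi_trudi m (beads lam) :: 'a tpoly)"
    by (simp add: jacobi_trudi_beads lam m_def)
  also have "\<dots> = (\<Sum>mu | border_strip k mu lam. (-1) ^ ht (skew mu lam) * jacobi_trudi m (beads mu))"
    unfolding power_sum_times_jacobi_trudi[OF lam k eq_refl[OF m_def[symmetric]]]
    by (rule sum_add_border_strips[OF alternating_jacobi_trudi lam k eq_refl[OF m_def[symmetric]]])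
  also have "\<dots> = (\<Sum>mu | border_strip k mu lam. (-1) ^ ht (skew mu lam) * schur mu)"
  proof (intro sum.cong refl)
    fix mu assume "mu \<in> {mu. border_strip k mu lam}"
    then have "border_strip k mu lam" by simp
    from border_strip_partitions(1)[OF this] border_strip_nrows(2)[OF this]
    show "(-1) ^ ht (skew mu lam) * jacobi_trudi m (beads mu) = (-1) ^ ht (skew mu lam) * (schur mu :: 'a tpoly)"
      by (simp add: jacobi_trudi_beads m_def)
  qed
  finally show ?thesis .
qed

lemma murnaghan_nakayama_deriv:
  assumes lam: "is_partition lam" and k: "k \<ge> 1"
  shows "tderiv k (schur lam) =
    (\<Sum>mu | border_strip k lam mu. (-1) ^ ht (skew lam mu) * schur mu :: 'a::field_char_0 tpoly)"
proof -
  define m where "m = nrows lam"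
  have "tderiv k (schur lam) = tderiv k (jacobi_trudi m (beads lam) :: 'a tpoly)"
    by (simp add: jacobi_trudi_beads lam m_def)
  also have "\<dots> = (\<Sum>mu | border_strip k lam mu. (-1) ^ ht (skew lam mu) * jacobi_trudi m (beads mu))"
    unfolding tderiv_jacobi_trudi[OF k]
    by (rule sum_remove_border_strips[OF alternating_jacobi_trudi lam k]) (auto simp: m_def intro: jacobi_trudi_off_board)
  also have "\<dots> = (\<Sum>mu | border_strip k lam mu. (-1) ^ ht (skew lam mu) * schur mu)"
  proof (intro sum.cong refl)
    fix mu assume "mu \<in> {mu. border_strip k lam mu}"
    then have "border_strip k lam mu" by simp
    from border_strip_partitions(2)[OF this] border_strip_nrows(1)[OF this]
    show "(-1) ^ ht (skew lam mu) * jacobi_trudi m (beads mu) = (-1) ^ ht (skew lam mu) * (schur mu :: 'a tpoly)"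
      by (simp add: jacobi_trudi_beads m_def)
  qed
  finally show ?thesis .
qed


section \<open>Cancellation of the terms that move two beads\<close>

lemma eq_minus_self: "x = - x \<Longrightarrow> x = 0" for x :: "'a::field_char_0"
  by (simp add: eq_neg_iff_add_eq_0 flip: mult_2)

text \<open>Bead \<open>r\<close> moves by \<open>i\<close>, then bead \<open>s\<close> by \<open>n - i\<close>. For \<open>r \<noteq> s\<close>, add up the contributions of the
  ordered pairs \<open>(r, s)\<close> and \<open>(s, r)\<close>. The one half disappears, and what results is the sum of
  \<open>f r s i\<close> over all integers \<open>i\<close> that keep both beads on the board; \<open>i = 0\<close> and \<open>i = n\<close> may be
  included because then a single bead moves by \<open>n\<close>. Exchanging the final positions of the two
  beads is an involution on this range of \<open>i\<close>, and it changes the sign.\<close>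

lemma two_bead_cancellation:
  fixes F :: "(nat \<Rightarrow> int) \<Rightarrow> 'a::field_char_0" and n :: int and b :: "nat \<Rightarrow> int"
  defines "f r s i \<equiv> F (b(r := b r + i, s := (b(r := b r + i)) s + (n - i)))"
  assumes F: "alternating m F" and n: "n \<ge> 1"
    and b: "\<And>i. i < m \<Longrightarrow> - int m < b i"
    and single: "\<And>r. r < m \<Longrightarrow> F (b(r := b r + n)) = 0"
  shows "(\<Sum>r<m. \<Sum>s<m. (\<Sum>i\<in>{1 - int m - b r..-1}. f r s i) + 1/2 * (\<Sum>i\<in>{1..n - 1}. f r s i)) = 0"
    (is "(\<Sum>r<m. \<Sum>s<m. ?A r s) = 0")
proof -
  have same: "f r r i = 0" if "r < m" for r i
    using single[OF that] by (simp add: f_def)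
  have neq: "?A r s + ?A s r = 0" if rs: "r < m" "s < m" "r \<noteq> s" for r s
  proof -
    let ?lo = "1 - int m - b r" and ?hi = "n + int m - 1 + b s"
    have f_eq: "f r s i = F (b(r := b r + i, s := b s + (n - i)))" for i
      using rs by (simp add: f_def)
    have sym: "f s r i = f r s (n - i)" for i
      using rs by (simp add: f_def fun_upd_twist)
    have f_0: "f r s 0 = 0" "f r s n = 0"
    proof -
      have "b(r := b r, s := b s + n) = b(s := b s + n)" "b(r := b r + n, s := b s) = b(r := b r + n)"
        using rs by auto
      then show "f r s 0 = 0" "f r s n = 0"
        using single[OF rs(1)] single[OF rs(2)] by (simp_all add: f_eq)
    qed
    have swap: "f r s i = - f r s (b s - b r + n - i)" for i
    proof -
      define c where "c = b(r := b s + (n - i), s := b r + i)"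
      have "b(r := b r + i, s := b s + (n - i)) = c(r := c s, s := c r)"
        using rs by (auto simp: c_def)
      then have "f r s i = - F c" by (simp only: f_eq alternating_swap[OF F rs])
      also have "c = b(r := b r + (b s - b r + n - i), s := b s + (n - (b s - b r + n - i)))"
        by (simp add: c_def)
      finally show ?thesis by (simp only: f_eq)
    qed
    have "(\<Sum>i\<in>{?lo..?hi}. f r s i) = (\<Sum>i\<in>{?lo..?hi}. - f r s i)"
    proof (rule sum.reindex_bij_witness[of _ "\<lambda>i. b s - b r + n - i" "\<lambda>i. b s - b r + n - i"])
      show "- f r s (b s - b r + n - i) = f r s i" for i using swap[of i] by simp
    qed auto
    then have zero: "(\<Sum>i\<in>{?lo..?hi}. f r s i) = 0"
      by (intro eq_minus_self) (simp add: sum_negf)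
    have upper: "(\<Sum>i\<in>{1 - int m - b s..-1}. f s r i) = (\<Sum>i\<in>{n + 1..?hi}. f r s i)"
      by (rule sum.reindex_bij_witness[of _ "\<lambda>i. n - i" "\<lambda>i. n - i"]) (auto simp: sym)
    have middle: "(\<Sum>i\<in>{1..n - 1}. f s r i) = (\<Sum>i\<in>{1..n - 1}. f r s i)"
      by (rule sum.reindex_bij_witness[of _ "\<lambda>i. n - i" "\<lambda>i. n - i"]) (auto simp: sym)
    \<comment> \<open>The range splits into removals by \<open>r\<close>, the two single moves, two additions, removals by \<open>s\<close>.\<close>
    have "{?lo..?hi} = {?lo..-1} \<union> ({0, n} \<union> ({1..n - 1} \<union> {n + 1..?hi}))"
      using b[OF rs(1)] b[OF rs(2)] n by auto
    also have "sum (f r s) \<dots> = sum (f r s) {?lo..-1} +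
        (sum (f r s) {0, n} + (sum (f r s) {1..n - 1} + sum (f r s) {n + 1..?hi}))"
      using n by (subst sum.union_disjoint; (auto; fail)?)+
    finally have "sum (f r s) {?lo..-1} + (sum (f r s) {1..n - 1} + sum (f r s) {n + 1..?hi}) = 0"
      using n zero by (simp add: f_0)
    then show ?thesis unfolding upper middle by (simp add: algebra_simps)
  qed
  have pair: "?A r s + ?A s r = 0" if "r < m" "s < m" for r s
    using neq[OF that] same[OF that(1)] by (cases "r = s") simp_all
  have "(\<Sum>r<m. \<Sum>s<m. ?A r s) = (\<Sum>r<m. \<Sum>s<m. - ?A s r)"
  proof (intro sum.cong refl)
    fix r s assume "r \<in> {..<m}" "s \<in> {..<m}"
    then have "?A r s + ?A s r = 0" by (intro pair) simp_all
    then show "?A r s = - ?A s r" by (simp only: eq_neg_iff_add_eq_0)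
  qed
  also have "\<dots> = - (\<Sum>r<m. \<Sum>s<m. ?A r s)"
    unfolding sum_negf by (subst sum.swap) (rule refl)
  finally show ?thesis by (rule eq_minus_self)
qed


section \<open>Coefficients of paths through two border strips\<close>

text \<open>A linear functional that reads off the coefficient of a single partition \<open>mu\<close>, extended to
  an alternating function of bead positions.\<close>

definition bead_indicator :: "nat \<Rightarrow> (nat \<Rightarrow> nat) \<Rightarrow> (nat \<Rightarrow> int) \<Rightarrow> 'a::comm_ring_1" where
  "bead_indicator m mu = row_det m (\<lambda>x l. if x = beads mu l then 1 else 0)"

text \<open>The beads before the first difference are common to both partitions and lie higher, and all other
  beads of \<open>mu\<close> lie lower.\<close>

lemma first_larger_bead_missing:
  assumes nu: "is_partition nu" and mu: "is_partition mu"
    and eq: "\<And>j. j < i \<Longrightarrow> nu j = mu j" and less: "mu i < nu i"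
  shows "beads nu i \<notin> range (beads mu)"
proof
  assume "beads nu i \<in> range (beads mu)"
  then obtain l where l: "beads nu i = beads mu l" by auto
  show False
  proof (cases "l < i")
    case True
    then show ?thesis using beads_less[OF nu True] eq[OF True] l by (simp add: beads_def)
  next
    case False
    then have "beads mu l \<le> beads mu i"
      using beads_less[OF mu, of i l] by (cases "l = i") auto
    then show ?thesis using l less by (simp add: beads_def)
  qed
qed

lemma bead_indicator_beads:
  assumes nu: "is_partition nu" "nrows nu \<le> m" and mu: "is_partition mu" "nrows mu \<le> m"
  shows "bead_indicator m mu (beads nu) = (if nu = mu then 1 else 0 :: 'a::comm_ring_1)"
proof (cases "nu = mu")
  case True
  have "mat m m (\<lambda>(i, j). if beads mu i = beads mu j then 1 else 0 :: 'a) = 1\<^sub>m m"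
    by (rule eq_matI) (auto simp: beads_inj[OF mu(1)])
  then show ?thesis using True by (simp add: bead_indicator_def row_det_def)
next
  case False
  define i where "i = (LEAST i. nu i \<noteq> mu i)"
  have diff: "nu i \<noteq> mu i" unfolding i_def by (rule LeastI_ex) (use False in \<open>simp add: fun_eq_iff\<close>)
  have eq: "nu j = mu j" if "j < i" for j
    using not_less_Least[of j "\<lambda>i. nu i \<noteq> mu i"] that by (simp add: i_def)
  have im: "i < m"
  proof (rule ccontr)
    assume "\<not> i < m"
    then have "nrows nu \<le> i" "nrows mu \<le> i" using nu mu by simp_all
    then have "beads nu i = beads mu i" by (simp only: beads_beyond[OF nu(1)] beads_beyond[OF mu(1)])
    then show False using diff by (simp add: beads_def)
  qed
  have "\<exists>r<m. \<forall>l<m. beads nu r \<noteq> beads mu l"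
  proof (rule ccontr)
    assume "\<not> (\<exists>r<m. \<forall>l<m. beads nu r \<noteq> beads mu l)"
    then have "beads nu ` {..<m} \<subseteq> beads mu ` {..<m}" by blast
    moreover have "card (beads nu ` {..<m}) = m" "card (beads mu ` {..<m}) = m"
      by (subst card_image; simp add: inj_on_def beads_inj[OF nu(1)] beads_inj[OF mu(1)])+
    ultimately have img: "beads nu ` {..<m} = beads mu ` {..<m}"
      by (intro card_subset_eq) auto
    show False
    proof (cases "mu i < nu i")
      case True
      have "beads nu i \<in> beads mu ` {..<m}" using im img by blast
      then show ?thesis using first_larger_bead_missing[OF nu(1) mu(1) eq True] by blast
    next
      case False
      then have "nu i < mu i" using diff by simp
      then have "beads mu i \<notin> range (beads nu)"
        using eq by (intro first_larger_bead_missing[OF mu(1) nu(1)]) simp_all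
      moreover have "beads mu i \<in> beads nu ` {..<m}" using im img by blast
      ultimately show ?thesis by blast
    qed
  qed
  then obtain r where "r < m" "\<forall>l<m. beads nu r \<noteq> beads mu l" by blast
  then have "bead_indicator m mu (beads nu) = (0 :: 'a)"
    unfolding bead_indicator_def by (intro row_det_zero_row[of r]) auto
  then show ?thesis using False by simp
qed

lemma alternating_bead_indicator: "alternating m (bead_indicator m mu)"
  unfolding bead_indicator_def by (rule alternating_row_det)

lemma bead_indicator_add_strip:
  assumes nu: "is_partition nu" "nrows nu + k \<le> m" and mu: "is_partition mu" "nrows mu \<le> m"
    and k: "k \<ge> 1"
  shows "(\<Sum>s<m. bead_indicator m mu ((beads nu)(s := beads nu s + int k))) =
    (if border_strip k mu nu then (-1) ^ ht (skew mu nu) else 0 :: 'a::comm_ring_1)"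
proof -
  have "(\<Sum>s<m. bead_indicator m mu ((beads nu)(s := beads nu s + int k))) =
      (\<Sum>mu' | border_strip k mu' nu. (-1) ^ ht (skew mu' nu) * bead_indicator m mu (beads mu') :: 'a)"
    by (rule sum_add_border_strips[OF alternating_bead_indicator nu(1) k nu(2)])
  also have "\<dots> = (\<Sum>mu' | border_strip k mu' nu. if mu' = mu then (-1) ^ ht (skew mu nu) else 0)"
  proof (intro sum.cong refl)
    fix mu' assume "mu' \<in> {mu'. border_strip k mu' nu}"
    then have strip: "border_strip k mu' nu" by simp
    have "bead_indicator m mu (beads mu') = (if mu' = mu then 1 else 0 :: 'a)"
      using border_strip_nrows(2)[OF strip] nu(2)
      by (intro bead_indicator_beads border_strip_partitions(1)[OF strip] mu) simp
    then show "(-1) ^ ht (skew mu' nu) * bead_indicator m mu (beads mu') =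
        (if mu' = mu then (-1) ^ ht (skew mu nu) else 0 :: 'a)" by simp
  qed
  also have "\<dots> = (if border_strip k mu nu then (-1) ^ ht (skew mu nu) else 0)"
    by (simp add: sum.delta finite_add_border_strip)
  finally show ?thesis .
qed

text \<open>The coefficient of \<open>s\<^sub>\<mu>\<close> in \<open>V\<^sub>-\<^sub>n s\<^sub>\<lambda>\<close>, and of \<open>s\<^sub>\<lambda>\<close> in \<open>V\<^sub>n s\<^sub>\<mu>\<close>, that results from applying the
  Murnaghan-Nakayama rules term by term. The bound \<open>N\<close> on the size of the removed strip is a
  parameter because the two expansions naturally come with different bounds; all values from
  \<open>card (diagram lam)\<close> on give the same coefficient.\<close>

definition path_coef :: "nat \<Rightarrow> nat \<Rightarrow> (nat \<Rightarrow> nat) \<Rightarrow> (nat \<Rightarrow> nat) \<Rightarrow> 'a::field_char_0" where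
  "path_coef N n lam mu =
     (\<Sum>j=1..N. \<Sum>nu | border_strip j lam nu \<and> border_strip (n + j) mu nu.
        (-1) ^ (ht (skew lam nu) + ht (skew mu nu)))
   + 1/2 * (\<Sum>i=1..n - 1. \<Sum>nu | border_strip i nu lam \<and> border_strip (n - i) mu nu.
        (-1) ^ (ht (skew nu lam) + ht (skew mu nu)))"

lemma border_strip_size_le: "border_strip k lam nu \<Longrightarrow> k \<le> card (diagram lam)"
  by (simp add: border_strip_card)

lemma removal_sum_empty:
  assumes "card (diagram lam) < j"
  shows "(\<Sum>nu | border_strip j lam nu \<and> P nu. f nu) = 0"
  using assms by (intro sum.neutral) (auto dest: border_strip_size_le)

lemma path_coef_bound:
  assumes "card (diagram lam) \<le> N"
  shows "path_coef N n lam mu = path_coef (card (diagram lam)) n lam mu"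
proof -
  have "(\<Sum>j=1..N. \<Sum>nu | border_strip j lam nu \<and> border_strip (n + j) mu nu.
        (-1) ^ (ht (skew lam nu) + ht (skew mu nu)) :: 'a) =
      (\<Sum>j=1..card (diagram lam). \<Sum>nu | border_strip j lam nu \<and> border_strip (n + j) mu nu.
        (-1) ^ (ht (skew lam nu) + ht (skew mu nu)))"
    using assms by (intro sum.mono_neutral_right ballI) (auto intro: removal_sum_empty)
  then show ?thesis by (simp add: path_coef_def)
qed

text \<open>The inner sum has to be restricted to beads on the board: a bead that has left the board in the
  first step, which corresponds to no partition, could come back in the second.\<close>

lemma path_coef_removal_bead_sum:
  assumes lam: "is_partition lam" and mu: "is_partition mu" "nrows mu \<le> m"
    and m: "nrows lam + n + card (diagram lam) \<le> m" and j: "j \<ge> 1"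
  shows "(\<Sum>nu | border_strip j lam nu \<and> border_strip (n + j) mu nu.
        (-1) ^ (ht (skew lam nu) + ht (skew mu nu))) =
    (\<Sum>r<m. on_board m (\<lambda>c. \<Sum>s<m. bead_indicator m mu (c(s := c s + int (n + j))))
       ((beads lam)(r := beads lam r - int j)) :: 'a::comm_ring_1)"
proof -
  let ?S = "\<lambda>c. \<Sum>s<m. bead_indicator m mu (c(s := c s + int (n + j))) :: 'a"
  have "(\<Sum>nu | border_strip j lam nu \<and> border_strip (n + j) mu nu.
        (-1) ^ (ht (skew lam nu) + ht (skew mu nu))) =
      (\<Sum>nu | border_strip j lam nu. (-1) ^ ht (skew lam nu) * on_board m ?S (beads nu))"
  proof (rule sum.mono_neutral_cong_left)
    have S: "on_board m ?S (beads nu) =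
        (if border_strip (n + j) mu nu then (-1) ^ ht (skew mu nu) else 0)" if "border_strip j lam nu" for nu
      unfolding on_board_beads
      using border_strip_nrows(1)[OF that] border_strip_card[OF that] m j
      by (intro bead_indicator_add_strip border_strip_partitions(2)[OF that] mu) simp_all
    show "\<forall>nu\<in>{nu. border_strip j lam nu} - {nu. border_strip j lam nu \<and> border_strip (n + j) mu nu}.
        (-1) ^ ht (skew lam nu) * on_board m ?S (beads nu) = 0"
      by (auto simp: S simp del: of_nat_add)
    show "(-1) ^ (ht (skew lam nu) + ht (skew mu nu)) = (-1) ^ ht (skew lam nu) * on_board m ?S (beads nu)"
      if "nu \<in> {nu. border_strip j lam nu \<and> border_strip (n + j) mu nu}" for nu
      using that S[of nu] by (simp only: mem_Collect_eq if_True power_add)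
  qed (auto simp: finite_remove_border_strip)
  also have "\<dots> = (\<Sum>r<m. on_board m ?S ((beads lam)(r := beads lam r - int j)))"
  proof (rule sum_remove_border_strips[symmetric])
    show "alternating m (on_board m ?S)"
      by (intro alternating_on_board alternating_sum_shifts alternating_bead_indicator)
    show "on_board m ?S c = 0" if "r < m" "c r \<le> - int m" for c r
      using that by (auto simp: on_board_def)
  qed (use lam j m in auto)
  finally show ?thesis .
qed

lemma path_coef_addition_bead_sum:
  assumes lam: "is_partition lam" and mu: "is_partition mu" "nrows mu \<le> m"
    and m: "nrows lam + n \<le> m" and i: "1 \<le> i" "i < n"
  shows "(\<Sum>nu | border_strip i nu lam \<and> border_strip (n - i) mu nu.
        (-1) ^ (ht (skew nu lam) + ht (skew mu nu))) =
    (\<Sum>r<m. (\<lambda>c. \<Sum>s<m. bead_indicator m mu (c(s := c s + int (n - i))))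
       ((beads lam)(r := beads lam r + int i)) :: 'a::comm_ring_1)"
proof -
  let ?S = "\<lambda>c. \<Sum>s<m. bead_indicator m mu (c(s := c s + int (n - i))) :: 'a"
  have "(\<Sum>nu | border_strip i nu lam \<and> border_strip (n - i) mu nu.
        (-1) ^ (ht (skew nu lam) + ht (skew mu nu))) =
      (\<Sum>nu | border_strip i nu lam. (-1) ^ ht (skew nu lam) * ?S (beads nu))"
  proof (rule sum.mono_neutral_cong_left)
    have S: "?S (beads nu) =
        (if border_strip (n - i) mu nu then (-1) ^ ht (skew mu nu) else 0)" if "border_strip i nu lam" for nu
      using border_strip_nrows(2)[OF that] m i
      by (intro bead_indicator_add_strip border_strip_partitions(1)[OF that] mu) simp_all
    show "\<forall>nu\<in>{nu. border_strip i nu lam} - {nu. border_strip i nu lam \<and> border_strip (n - i) mu nu}.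
        (-1) ^ ht (skew nu lam) * ?S (beads nu) = 0"
      by (auto simp: S simp del: of_nat_diff)
    show "(-1) ^ (ht (skew nu lam) + ht (skew mu nu)) = (-1) ^ ht (skew nu lam) * ?S (beads nu)"
      if "nu \<in> {nu. border_strip i nu lam \<and> border_strip (n - i) mu nu}" for nu
      using that S[of nu] by (simp only: mem_Collect_eq if_True power_add)
  qed (auto simp: finite_add_border_strip)
  also have "\<dots> = (\<Sum>r<m. ?S ((beads lam)(r := beads lam r + int i)))"
    using m i by (intro sum_add_border_strips[symmetric] alternating_sum_shifts
      alternating_bead_indicator lam) auto
  finally show ?thesis .
qed

text \<open>Only the paths that move two different beads can lead to a partition which is not \<open>lam\<close> plus a
  strip of size \<open>n\<close>, and these cancel.\<close>

lemma path_coef_zero: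
  assumes lam: "is_partition lam" and mu: "is_partition mu" and n: "n \<ge> 1"
    and no_strip: "\<not> border_strip n mu lam" and N: "card (diagram lam) \<le> N"
  shows "path_coef N n lam mu = (0 :: 'a::field_char_0)"
proof -
  define m where "m = nrows lam + nrows mu + n + card (diagram lam)"
  \<comment> \<open>Large enough for every downward move of a bead that stays on the board.\<close>
  define K where "K = card (diagram lam) + m"
  let ?b = "beads lam"
  define F :: "(nat \<Rightarrow> int) \<Rightarrow> 'a" where "F = bead_indicator m mu"
  have F: "alternating m F" unfolding F_def by (rule alternating_bead_indicator)
  define f where "f r s i = F (?b(r := ?b r + i, s := (?b(r := ?b r + i)) s + (int n - i)))" for r s i
  have bound: "?b r \<le> int (card (diagram lam))" for r
  proof -
    have "{r} \<times> {..<lam r} \<subseteq> diagram lam" by (auto simp: diagram_def)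
    from card_mono[OF finite_diagram[OF lam] this] show ?thesis by (simp add: beads_def)
  qed
  have first: "(\<Sum>j=1..K. \<Sum>nu | border_strip j lam nu \<and> border_strip (n + j) mu nu.
        (-1) ^ (ht (skew lam nu) + ht (skew mu nu))) =
      (\<Sum>r<m. \<Sum>i\<in>{1 - int m - ?b r..-1}. \<Sum>s<m. f r s i)"
  proof -
    have cut: "on_board m (\<lambda>c. \<Sum>s<m. F (c(s := c s + int (n + j)))) (?b(r := ?b r - int j)) =
        (if - int m < ?b r - int j then \<Sum>s<m. f r s (- int j) else 0)" if "r < m" for r j
    proof (cases "- int m < ?b r - int j")
      case True
      then have "\<not> (\<exists>i<m. (?b(r := ?b r - int j)) i \<le> - int m)"
        using beads_above[of _ m lam] by (auto simp: not_le)
      then show ?thesis using True unfolding on_board_def by (simp only: if_False if_True f_def) simp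
    next
      case False
      then show ?thesis using that by (auto simp: on_board_def)
    qed
    have "(\<Sum>j=1..K. \<Sum>nu | border_strip j lam nu \<and> border_strip (n + j) mu nu.
        (-1) ^ (ht (skew lam nu) + ht (skew mu nu))) =
      (\<Sum>j=1..K. \<Sum>r<m. if - int m < ?b r - int j then \<Sum>s<m. f r s (- int j) else 0)"
    proof (intro sum.cong refl)
      fix j assume "j \<in> {1..K}"
      then have "(\<Sum>nu | border_strip j lam nu \<and> border_strip (n + j) mu nu.
          (-1) ^ (ht (skew lam nu) + ht (skew mu nu))) =
        (\<Sum>r<m. on_board m (\<lambda>c. \<Sum>s<m. F (c(s := c s + int (n + j)))) (?b(r := ?b r - int j)))"
        unfolding F_def by (intro path_coef_removal_bead_sum lam mu) (auto simp: m_def)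
      also have "\<dots> = (\<Sum>r<m. if - int m < ?b r - int j then \<Sum>s<m. f r s (- int j) else 0)"
        by (intro sum.cong refl cut) simp
      finally show "(\<Sum>nu | border_strip j lam nu \<and> border_strip (n + j) mu nu.
          (-1) ^ (ht (skew lam nu) + ht (skew mu nu))) =
        (\<Sum>r<m. if - int m < ?b r - int j then \<Sum>s<m. f r s (- int j) else 0)" .
    qed
    also have "\<dots> = (\<Sum>r<m. \<Sum>j=1..K. if - int m < ?b r - int j then \<Sum>s<m. f r s (- int j) else 0)"
      by (rule sum.swap)
    also have "\<dots> = (\<Sum>r<m. \<Sum>i\<in>{1 - int m - ?b r..-1}. \<Sum>s<m. f r s i)"
    proof (intro sum.cong refl)
      fix r
      have "(\<Sum>j=1..K. if - int m < ?b r - int j then \<Sum>s<m. f r s (- int j) else 0) =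
          (\<Sum>j\<in>{j\<in>{1..K}. - int m < ?b r - int j}. \<Sum>s<m. f r s (- int j))"
        by (rule sum.inter_filter[symmetric]) simp
      also have "\<dots> = (\<Sum>i\<in>{1 - int m - ?b r..-1}. \<Sum>s<m. f r s i)"
        by (rule sum.reindex_bij_witness[of _ "\<lambda>i. nat (- i)" "\<lambda>j. - int j"])
           (use bound[of r] in \<open>auto simp: K_def\<close>)
      finally show "(\<Sum>j=1..K. if - int m < ?b r - int j then \<Sum>s<m. f r s (- int j) else 0) =
          (\<Sum>i\<in>{1 - int m - ?b r..-1}. \<Sum>s<m. f r s i)" .
    qed
    finally show ?thesis .
  qed
  have second: "(\<Sum>i=1..n - 1. \<Sum>nu | border_strip i nu lam \<and> border_strip (n - i) mu nu.
        (-1) ^ (ht (skew nu lam) + ht (skew mu nu))) =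
      (\<Sum>r<m. \<Sum>i\<in>{1..int n - 1}. \<Sum>s<m. f r s i)"
  proof -
    have "(\<Sum>i=1..n - 1. \<Sum>nu | border_strip i nu lam \<and> border_strip (n - i) mu nu.
          (-1) ^ (ht (skew nu lam) + ht (skew mu nu))) =
        (\<Sum>i=1..n - 1. \<Sum>r<m. \<Sum>s<m. f r s (int i))"
    proof (intro sum.cong refl)
      fix i assume "i \<in> {1..n - 1}"
      then have i: "1 \<le> i" "i < n" by auto
      then have sub: "int (n - i) = int n - int i" by (simp add: of_nat_diff)
      have "(\<Sum>nu | border_strip i nu lam \<and> border_strip (n - i) mu nu.
            (-1) ^ (ht (skew nu lam) + ht (skew mu nu))) =
          (\<Sum>r<m. \<Sum>s<m. F (?b(r := ?b r + int i, s := (?b(r := ?b r + int i)) s + int (n - i))))"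
        unfolding F_def by (rule path_coef_addition_bead_sum[OF lam mu _ _ i]) (simp_all add: m_def)
      then show "(\<Sum>nu | border_strip i nu lam \<and> border_strip (n - i) mu nu.
            (-1) ^ (ht (skew nu lam) + ht (skew mu nu))) = (\<Sum>r<m. \<Sum>s<m. f r s (int i))"
        by (simp only: f_def sub)
    qed
    also have "\<dots> = (\<Sum>i\<in>{1..int n - 1}. \<Sum>r<m. \<Sum>s<m. f r s i)"
      by (rule sum.reindex_bij_witness[of _ nat int]) auto
    also have "\<dots> = (\<Sum>r<m. \<Sum>i\<in>{1..int n - 1}. \<Sum>s<m. f r s i)"
      by (rule sum.swap)
    finally show ?thesis .
  qed
  \<comment> \<open>This is where the hypothesis on \<open>mu\<close> enters.\<close>
  have single: "F (?b(r := ?b r + int n)) = 0" if r: "r < m" for r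
  proof (cases "?b r + int n \<in> range ?b")
    case True
    then obtain i where i: "?b i = ?b r + int n" by auto
    have "i < r"
      using beads_less[OF lam, of r i] i n by (cases i r rule: linorder_cases) auto
    then show ?thesis using r i by (intro alternating_collision[OF F, of r i]) auto
  next
    case False
    then obtain s nu where nu: "is_partition nu" and jump: "bead_jump n s r lam nu"
      using bead_jump_up_exists[OF lam n] by blast
    have strip: "border_strip n nu lam" by (rule bead_jump_border_strip(1)[OF jump n lam nu])
    then have "F (beads nu) = 0"
      using bead_indicator_beads[OF nu _ mu, of m, where 'a = 'a] border_strip_nrows(2)[OF strip] no_strip
      by (auto simp: F_def m_def)
    then show ?thesis using bead_jump_up_alternating[OF F jump r] by simp
  qed
  have K: "card (diagram lam) \<le> K" by (simp add: K_def)
  have "path_coef N n lam mu = (path_coef K n lam mu :: 'a)"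
    by (simp only: path_coef_bound[OF N] path_coef_bound[OF K])
  also have "\<dots> = (\<Sum>r<m. \<Sum>i\<in>{1 - int m - ?b r..-1}. \<Sum>s<m. f r s i) +
      1/2 * (\<Sum>r<m. \<Sum>i\<in>{1..int n - 1}. \<Sum>s<m. f r s i)"
    unfolding path_coef_def first second ..
  also have "\<dots> = (\<Sum>r<m. \<Sum>s<m. (\<Sum>i\<in>{1 - int m - ?b r..-1}. f r s i) +
      1/2 * (\<Sum>i\<in>{1..int n - 1}. f r s i))"
  proof -
    have "(\<Sum>i\<in>I. \<Sum>s<m. f r s i) = (\<Sum>s<m. \<Sum>i\<in>I. f r s i)" for r I
      by (rule sum.swap)
    then show ?thesis by (simp only: sum.distrib sum_distrib_left)
  qed
  also have "\<dots> = 0"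
    unfolding f_def by (rule two_bead_cancellation[OF F _ beads_above single]) (use n in simp_all)
  finally show ?thesis .
qed

text \<open>The requirement \<open>\<lambda>\<setminus>\<nu> \<subseteq> \<mu>\<setminus>\<nu>\<close> follows from \<open>\<lambda> \<subseteq> \<mu>\<close>.\<close>

lemma dcoef_eq_path_coef:
  assumes strip: "border_strip n mu lam" and N: "card (diagram lam) \<le> N"
  shows "dcoef n lam mu = (path_coef N n lam mu :: 'a::field_char_0)"
proof -
  have sub: "skew lam nu \<subseteq> skew mu nu" for nu
    using strip by (auto simp: border_strip_def skew_def)
  have "Sum_any (\<lambda>i. (\<Sum>nu | border_strip i lam nu \<and> border_strip (n + i) mu nu.
        (-1) ^ (ht (skew lam nu) + ht (skew mu nu)) :: 'a) when 1 \<le> i) =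
      (\<Sum>i=1..card (diagram lam). (\<Sum>nu | border_strip i lam nu \<and> border_strip (n + i) mu nu.
        (-1) ^ (ht (skew lam nu) + ht (skew mu nu))) when 1 \<le> i)"
  proof (intro Sum_any.expand_superset subsetI)
    fix i assume "i \<in> {i. ((\<Sum>nu | border_strip i lam nu \<and> border_strip (n + i) mu nu.
        (-1) ^ (ht (skew lam nu) + ht (skew mu nu)) :: 'a) when 1 \<le> i) \<noteq> 0}"
    then have "\<not> card (diagram lam) < i" "1 \<le> i"
      using removal_sum_empty[of lam i] by (auto simp: when_def split: if_splits)
    then show "i \<in> {1..card (diagram lam)}" by simp
  qed simp
  also have "\<dots> = (\<Sum>i=1..card (diagram lam). \<Sum>nu | border_strip i lam nu \<and> border_strip (n + i) mu nu.
        (-1) ^ (ht (skew lam nu) + ht (skew mu nu)))"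
    by (intro sum.cong refl) simp
  finally show ?thesis
    unfolding path_coef_bound[OF N] by (simp only: dcoef_def path_coef_def sub simp_thms)
qed


section \<open>Expansion of the Virasoro operators\<close>

lemma two_strip_expansion:
  fixes a :: "'b \<Rightarrow> 'r::comm_ring_1"
  assumes "finite X" "finite M" and sub: "\<And>x mu. x \<in> X \<Longrightarrow> Q mu x \<Longrightarrow> mu \<in> M"
  shows "(\<Sum>x\<in>X. a x * (\<Sum>mu | Q mu x. c mu x * g mu)) =
    (\<Sum>mu\<in>M. (\<Sum>x | x \<in> X \<and> Q mu x. a x * c mu x) * g mu)"
proof -
  have "(\<Sum>x\<in>X. a x * (\<Sum>mu | Q mu x. c mu x * g mu)) =
      (\<Sum>x\<in>X. \<Sum>mu\<in>M. if Q mu x then a x * c mu x * g mu else 0)"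
  proof (intro sum.cong refl)
    fix x assume "x \<in> X"
    then have "{mu. Q mu x} = {mu \<in> M. Q mu x}" using sub by blast
    then have "a x * (\<Sum>mu | Q mu x. c mu x * g mu) = (\<Sum>mu\<in>{mu \<in> M. Q mu x}. a x * c mu x * g mu)"
      by (simp only: sum_distrib_left mult.assoc)
    then show "a x * (\<Sum>mu | Q mu x. c mu x * g mu) =
        (\<Sum>mu\<in>M. if Q mu x then a x * c mu x * g mu else 0)"
      by (simp only: sum.inter_filter[OF assms(2)])
  qed
  also have "\<dots> = (\<Sum>mu\<in>M. \<Sum>x\<in>X. if Q mu x then a x * c mu x * g mu else 0)"
    by (rule sum.swap)
  also have "\<dots> = (\<Sum>mu\<in>M. (\<Sum>x | x \<in> X \<and> Q mu x. a x * c mu x) * g mu)"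
    by (intro sum.cong refl) (subst sum_distrib_right, rule sum.inter_filter[OF assms(1), symmetric])
  finally show ?thesis .
qed

text \<open>Each term of a Virasoro operator performs two Murnaghan-Nakayama steps in succession. The results
  are collected over a finite set \<open>M\<close> of target partitions, so that different terms can be added up.\<close>

lemma remove_then_add:
  assumes lam: "is_partition lam" and a: "a \<ge> 1" and b: "b \<ge> 1" and M: "finite M"
    and sub: "\<And>nu mu. border_strip a lam nu \<Longrightarrow> border_strip b mu nu \<Longrightarrow> mu \<in> M"
  shows "of_nat b * tvar b * tderiv a (schur lam) =
    (\<Sum>mu\<in>M. Const (\<Sum>nu | border_strip a lam nu \<and> border_strip b mu nu.
        (-1) ^ (ht (skew lam nu) + ht (skew mu nu))) * schur mu :: 'a::field_char_0 tpoly)"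
proof -
  have "of_nat b * tvar b * tderiv a (schur lam) =
      (\<Sum>nu | border_strip a lam nu. (-1) ^ ht (skew lam nu) * (of_nat b * tvar b * schur nu) :: 'a tpoly)"
    unfolding murnaghan_nakayama_deriv[OF lam a] sum_distrib_left
    by (intro sum.cong refl) (simp add: algebra_simps)
  also have "\<dots> = (\<Sum>nu | border_strip a lam nu. (-1) ^ ht (skew lam nu) *
      (\<Sum>mu | border_strip b mu nu. (-1) ^ ht (skew mu nu) * schur mu))"
    by (intro sum.cong refl arg_cong2[of _ _ _ _ "(*)"] murnaghan_nakayama_mult[OF _ b])
       (auto dest: border_strip_partitions)
  also have "\<dots> = (\<Sum>mu\<in>M. (\<Sum>nu | nu \<in> {nu. border_strip a lam nu} \<and> border_strip b mu nu.
      (-1) ^ ht (skew lam nu) * (-1) ^ ht (skew mu nu)) * schur mu)"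
    by (rule two_strip_expansion) (use finite_remove_border_strip M sub in auto)
  finally show ?thesis
    by (simp only: mem_Collect_eq Const_sum Const_minus_one_power Const_simps(4) power_add)
qed

lemma add_then_add:
  assumes lam: "is_partition lam" and a: "a \<ge> 1" and b: "b \<ge> 1" and M: "finite M"
    and sub: "\<And>nu mu. border_strip a nu lam \<Longrightarrow> border_strip b mu nu \<Longrightarrow> mu \<in> M"
  shows "of_nat b * tvar b * (of_nat a * tvar a * schur lam) =
    (\<Sum>mu\<in>M. Const (\<Sum>nu | border_strip a nu lam \<and> border_strip b mu nu.
        (-1) ^ (ht (skew nu lam) + ht (skew mu nu))) * schur mu :: 'a::field_char_0 tpoly)"
proof -
  have "of_nat b * tvar b * (of_nat a * tvar a * schur lam) =
      (\<Sum>nu | border_strip a nu lam. (-1) ^ ht (skew nu lam) * (of_nat b * tvar b * schur nu) :: 'a tpoly)"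
    unfolding murnaghan_nakayama_mult[OF lam a] sum_distrib_left
    by (intro sum.cong refl) (simp add: algebra_simps)
  also have "\<dots> = (\<Sum>nu | border_strip a nu lam. (-1) ^ ht (skew nu lam) *
      (\<Sum>mu | border_strip b mu nu. (-1) ^ ht (skew mu nu) * schur mu))"
    by (intro sum.cong refl arg_cong2[of _ _ _ _ "(*)"] murnaghan_nakayama_mult[OF _ b])
       (auto dest: border_strip_partitions)
  also have "\<dots> = (\<Sum>mu\<in>M. (\<Sum>nu | nu \<in> {nu. border_strip a nu lam} \<and> border_strip b mu nu.
      (-1) ^ ht (skew nu lam) * (-1) ^ ht (skew mu nu)) * schur mu)"
    by (rule two_strip_expansion) (use finite_add_border_strip M sub in auto)
  finally show ?thesis
    by (simp only: mem_Collect_eq Const_sum Const_minus_one_power Const_simps(4) power_add)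
qed

lemma remove_then_remove:
  assumes lam: "is_partition lam" and a: "a \<ge> 1" and b: "b \<ge> 1" and M: "finite M"
    and sub: "\<And>nu mu. border_strip a lam nu \<Longrightarrow> border_strip b nu mu \<Longrightarrow> mu \<in> M"
  shows "tderiv b (tderiv a (schur lam)) =
    (\<Sum>mu\<in>M. Const (\<Sum>nu | border_strip b nu mu \<and> border_strip a lam nu.
        (-1) ^ (ht (skew nu mu) + ht (skew lam nu))) * schur mu :: 'a::field_char_0 tpoly)"
proof -
  have "tderiv b (tderiv a (schur lam)) =
      (\<Sum>nu | border_strip a lam nu. (-1) ^ ht (skew lam nu) * tderiv b (schur nu) :: 'a tpoly)"
    unfolding murnaghan_nakayama_deriv[OF lam a] by (simp only: tderiv_sum tderiv_minus_one_power_mult)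
  also have "\<dots> = (\<Sum>nu | border_strip a lam nu. (-1) ^ ht (skew lam nu) *
      (\<Sum>mu | border_strip b nu mu. (-1) ^ ht (skew nu mu) * schur mu))"
    by (intro sum.cong refl arg_cong2[of _ _ _ _ "(*)"] murnaghan_nakayama_deriv[OF _ b])
       (auto dest: border_strip_partitions)
  also have "\<dots> = (\<Sum>mu\<in>M. (\<Sum>nu | nu \<in> {nu. border_strip a lam nu} \<and> border_strip b nu mu.
      (-1) ^ ht (skew lam nu) * (-1) ^ ht (skew nu mu)) * schur mu)"
    by (rule two_strip_expansion) (use finite_remove_border_strip M sub in auto)
  finally show ?thesis
    by (simp only: mem_Collect_eq Const_sum Const_minus_one_power Const_simps(4) power_add conj_commute mult.commute)
qed

lemma sum_over_compositions:
  "(\<Sum>(i, j)\<in>{(i, j). 1 \<le> i \<and> 1 \<le> j \<and> int i + int j = int n}. f i j) = (\<Sum>i=1..n - 1. f i (n - i))"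
  by (rule sum.reindex_bij_witness[of _ "\<lambda>i. (i, n - i)" fst]) (auto intro!: arg_cong[where f = "f _"])

lemma tderiv_schur_large:
  assumes "is_partition lam" "card (diagram lam) < j"
  shows "tderiv j (schur lam) = (0 :: 'a::field_char_0 tpoly)"
proof -
  have "{mu. border_strip j lam mu} = {}" using assms(2) by (auto dest: border_strip_size_le)
  then show ?thesis using murnaghan_nakayama_deriv[OF assms(1), of j] assms(2) by simp
qed

lemma virasoro_neg_schur:
  assumes n: "n \<ge> 1" and lam: "is_partition lam"
  shows "virasoro (- int n) (schur lam) =
    (\<Sum>j=1..card (diagram lam). of_nat (n + j) * tvar (n + j) * tderiv j (schur lam)) +
    Const (1/2) * (\<Sum>i=1..n - 1. of_nat (n - i) * tvar (n - i) * (of_nat i * tvar i * schur lam)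
      :: 'a::field_char_0 tpoly)"
proof -
  let ?g = "\<lambda>(i, j). of_nat i * tvar i * tderiv j (schur lam :: 'a tpoly) when 1 \<le> i \<and> 1 \<le> j \<and> - int i + int j = - int n"
  let ?N = "card (diagram lam)"
  have "{(i, j). 1 \<le> i \<and> 1 \<le> j \<and> int i + int j = - int n} = {}" by auto
  moreover have "Sum_any ?g = (\<Sum>j=1..?N. of_nat (n + j) * tvar (n + j) * tderiv j (schur lam) :: 'a tpoly)"
  proof -
    have "Sum_any ?g = sum ?g ((\<lambda>j. (n + j, j)) ` {1..?N} :: (nat \<times> nat) set) "
    proof (rule Sum_any.expand_superset)
      show "{p. ?g p \<noteq> (0 :: 'a tpoly)} \<subseteq> (\<lambda>j. (n + j, j)) ` {1..?N}"
      proof (rule subsetI)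
        fix p :: "nat \<times> nat" assume p: "p \<in> {p. ?g p \<noteq> (0 :: 'a tpoly)}"
        obtain i j where ij: "p = (i, j)" by (cases p)
        from p have "(of_nat i * tvar i * tderiv j (schur lam) when
          1 \<le> i \<and> 1 \<le> j \<and> - int i + int j = - int n) \<noteq> (0 :: 'a tpoly)" unfolding ij by simp
        then have *: "1 \<le> j" "- int i + int j = - int n" "tderiv j (schur lam) \<noteq> (0 :: 'a tpoly)"
          by (auto simp: when_def split: if_splits)
        then have "\<not> ?N < j" using tderiv_schur_large[OF lam] by blast
        then show "p \<in> (\<lambda>j. (n + j, j)) ` {1..?N}" using * ij by (intro image_eqI[of _ _ j]) auto
      qed
    qed simp
    also have "\<dots> = (\<Sum>j=1..?N. of_nat (n + j) * tvar (n + j) * tderiv j (schur lam))"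
      by (subst sum.reindex) (auto simp: inj_on_def when_def intro!: sum.cong)
    finally show ?thesis .
  qed
  moreover have "{(i, j). 1 \<le> i \<and> 1 \<le> j \<and> - int i - int j = - int n} =
      {(i, j). 1 \<le> i \<and> 1 \<le> j \<and> int i + int j = int n}" by auto
  ultimately show ?thesis
    unfolding virasoro_def by (simp only: sum_over_compositions)
      (simp add: mult.assoc mult.left_commute cong: sum.cong)
qed

lemma virasoro_pos_schur:
  assumes n: "n \<ge> 1" and lam: "is_partition lam"
  shows "virasoro (int n) (schur lam) =
    Const (1/2) * (\<Sum>i=1..n - 1. tderiv i (tderiv (n - i) (schur lam))) +
    (\<Sum>j=1..card (diagram lam). of_nat j * tvar j * tderiv (n + j) (schur lam) :: 'a::field_char_0 tpoly)"
proof -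
  let ?g = "\<lambda>(i, j). of_nat i * tvar i * tderiv j (schur lam :: 'a tpoly) when 1 \<le> i \<and> 1 \<le> j \<and> - int i + int j = int n"
  let ?N = "card (diagram lam)"
  have "{(i, j). 1 \<le> i \<and> 1 \<le> j \<and> - int i - int j = int n} = {}" by auto
  moreover have "Sum_any ?g = (\<Sum>j=1..?N. of_nat j * tvar j * tderiv (n + j) (schur lam) :: 'a tpoly)"
  proof -
    have "Sum_any ?g = sum ?g ((\<lambda>i. (i, n + i)) ` {1..?N} :: (nat \<times> nat) set) "
    proof (rule Sum_any.expand_superset)
      show "{p. ?g p \<noteq> (0 :: 'a tpoly)} \<subseteq> (\<lambda>i. (i, n + i)) ` {1..?N}"
      proof (rule subsetI)
        fix p :: "nat \<times> nat" assume p: "p \<in> {p. ?g p \<noteq> (0 :: 'a tpoly)}"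
        obtain i j where ij: "p = (i, j)" by (cases p)
        from p have "(of_nat i * tvar i * tderiv j (schur lam) when
          1 \<le> i \<and> 1 \<le> j \<and> - int i + int j = int n) \<noteq> (0 :: 'a tpoly)" unfolding ij by simp
        then have *: "1 \<le> i" "- int i + int j = int n" "tderiv j (schur lam) \<noteq> (0 :: 'a tpoly)"
          by (auto simp: when_def split: if_splits)
        then have "\<not> ?N < j" using tderiv_schur_large[OF lam] by blast
        then show "p \<in> (\<lambda>i. (i, n + i)) ` {1..?N}" using * ij by (intro image_eqI[of _ _ i]) auto
      qed
    qed simp
    also have "\<dots> = (\<Sum>j=1..?N. of_nat j * tvar j * tderiv (n + j) (schur lam))"
      by (subst sum.reindex) (use n in \<open>auto simp: inj_on_def when_def intro!: sum.cong\<close>)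
    finally show ?thesis .
  qed
  ultimately show ?thesis
    unfolding virasoro_def by (simp only: sum_over_compositions) simp
qed

lemma sum_Const_mult:
  "(\<Sum>x\<in>A. \<Sum>mu\<in>M. Const (f x mu) * g mu) =
     (\<Sum>mu\<in>M. Const (\<Sum>x\<in>A. f x mu) * g mu :: 'a::field_char_0 tpoly)"
  unfolding Const_sum sum_distrib_right by (rule sum.swap)

lemma Const_half_sum:
  "Const (1/2) * (\<Sum>x\<in>A. \<Sum>mu\<in>M. Const (f x mu) * g mu) =
     (\<Sum>mu\<in>M. Const (1/2 * (\<Sum>x\<in>A. f x mu)) * g mu :: 'a::field_char_0 tpoly)"
  unfolding sum_Const_mult sum_distrib_left[where r = "Const (1/2)"] Const_simps(4)
  by (simp only: mult.assoc)

lemma virasoro_neg_schur_paths: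
  assumes n: "n \<ge> 1" and lam: "is_partition lam"
  shows "virasoro (- int n) (schur lam) =
    (\<Sum>mu | is_partition mu \<and> card (diagram mu) = card (diagram lam) + n.
       Const (path_coef (card (diagram lam)) n lam mu) * schur mu :: 'a::field_char_0 tpoly)"
proof -
  let ?N = "card (diagram lam)"
  let ?M = "{mu. is_partition mu \<and> card (diagram mu) = ?N + n}"
  let ?p = "\<lambda>j mu. \<Sum>nu | border_strip j lam nu \<and> border_strip (n + j) mu nu.
        (-1) ^ (ht (skew lam nu) + ht (skew mu nu)) :: 'a"
  let ?q = "\<lambda>i mu. \<Sum>nu | border_strip i nu lam \<and> border_strip (n - i) mu nu.
        (-1) ^ (ht (skew nu lam) + ht (skew mu nu)) :: 'a"
  have "of_nat (n + j) * tvar (n + j) * tderiv j (schur lam) =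
      (\<Sum>mu\<in>?M. Const (?p j mu) * schur mu)" if "j \<in> {1..?N}" for j
  proof (rule remove_then_add[OF lam])
    show "mu \<in> ?M" if "border_strip j lam nu" "border_strip (n + j) mu nu" for nu mu
      using border_strip_card[OF that(1)] border_strip_card[OF that(2)] border_strip_partitions[OF that(2)]
      by simp
  qed (use that finite_partitions_card in simp_all)
  then have "(\<Sum>j=1..?N. of_nat (n + j) * tvar (n + j) * tderiv j (schur lam)) =
      (\<Sum>j=1..?N. \<Sum>mu\<in>?M. Const (?p j mu) * schur mu)"
    by (intro sum.cong refl)
  also have "\<dots> = (\<Sum>mu\<in>?M. Const (\<Sum>j=1..?N. ?p j mu) * schur mu)"
    by (rule sum_Const_mult)
  finally have 1: "(\<Sum>j=1..?N. of_nat (n + j) * tvar (n + j) * tderiv j (schur lam)) = \<dots>" .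
  have "of_nat (n - i) * tvar (n - i) * (of_nat i * tvar i * schur lam) =
      (\<Sum>mu\<in>?M. Const (?q i mu) * schur mu)" if i: "i \<in> {1..n - 1}" for i
  proof (rule add_then_add[OF lam])
    show "mu \<in> ?M" if "border_strip i nu lam" "border_strip (n - i) mu nu" for nu mu
      using border_strip_card[OF that(1)] border_strip_card[OF that(2)] border_strip_partitions[OF that(2)] i
      by auto
  qed (use i finite_partitions_card in auto)
  then have "Const (1/2) * (\<Sum>i=1..n - 1. of_nat (n - i) * tvar (n - i) * (of_nat i * tvar i * schur lam)) =
      Const (1/2) * (\<Sum>i=1..n - 1. \<Sum>mu\<in>?M. Const (?q i mu) * schur mu)"
    by (intro arg_cong2[of _ _ _ _ "(*)"] sum.cong refl)
  also have "\<dots> = (\<Sum>mu\<in>?M. Const (1/2 * (\<Sum>i=1..n - 1. ?q i mu)) * schur mu)"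
    by (rule Const_half_sum)
  finally have 2: "Const (1/2) * (\<Sum>i=1..n - 1. of_nat (n - i) * tvar (n - i) * (of_nat i * tvar i * schur lam)) = \<dots>" .
  show ?thesis
    unfolding virasoro_neg_schur[OF n lam] 1 2 path_coef_def Const_simps(3) distrib_right sum.distrib ..
qed

lemma virasoro_pos_schur_paths:
  assumes n: "n \<ge> 1" and lam: "is_partition lam"
  shows "virasoro (int n) (schur lam) =
    (\<Sum>mu | is_partition mu \<and> card (diagram mu) = card (diagram lam) - n.
       Const (path_coef (card (diagram lam)) n mu lam) * schur mu :: 'a::field_char_0 tpoly)"
proof -
  let ?N = "card (diagram lam)"
  let ?M = "{mu. is_partition mu \<and> card (diagram mu) = ?N - n}"
  let ?p = "\<lambda>j mu. \<Sum>nu | border_strip j mu nu \<and> border_strip (n + j) lam nu.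
        (-1) ^ (ht (skew mu nu) + ht (skew lam nu)) :: 'a"
  let ?q = "\<lambda>i mu. \<Sum>nu | border_strip i nu mu \<and> border_strip (n - i) lam nu.
        (-1) ^ (ht (skew nu mu) + ht (skew lam nu)) :: 'a"
  have "of_nat j * tvar j * tderiv (n + j) (schur lam) =
      (\<Sum>mu\<in>?M. Const (?p j mu) * schur mu)" if j: "j \<in> {1..?N}" for j
  proof -
    have "of_nat j * tvar j * tderiv (n + j) (schur lam) =
      (\<Sum>mu\<in>?M. Const (\<Sum>nu | border_strip (n + j) lam nu \<and> border_strip j mu nu.
        (-1) ^ (ht (skew lam nu) + ht (skew mu nu)) :: 'a) * schur mu)"
  proof (rule remove_then_add[OF lam])
    show "mu \<in> ?M" if "border_strip (n + j) lam nu" "border_strip j mu nu" for nu mu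
      using border_strip_card[OF that(1)] border_strip_card[OF that(2)] border_strip_partitions[OF that(2)] j
      by simp
  qed (use j finite_partitions_card in simp_all)
    then show ?thesis by (simp only: conj_commute add.commute)
  qed
  then have "(\<Sum>j=1..?N. of_nat j * tvar j * tderiv (n + j) (schur lam)) =
      (\<Sum>j=1..?N. \<Sum>mu\<in>?M. Const (?p j mu) * schur mu)"
    by (intro sum.cong refl)
  also have "\<dots> = (\<Sum>mu\<in>?M. Const (\<Sum>j=1..?N. ?p j mu) * schur mu)"
    by (rule sum_Const_mult)
  finally have 1: "(\<Sum>j=1..?N. of_nat j * tvar j * tderiv (n + j) (schur lam)) = \<dots>" .
  have "tderiv i (tderiv (n - i) (schur lam)) =
      (\<Sum>mu\<in>?M. Const (?q i mu) * schur mu)" if i: "i \<in> {1..n - 1}" for i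
  proof (rule remove_then_remove[OF lam])
    show "mu \<in> ?M" if "border_strip (n - i) lam nu" "border_strip i nu mu" for nu mu
      using border_strip_card[OF that(1)] border_strip_card[OF that(2)] border_strip_partitions[OF that(2)] i
      by auto
  qed (use i finite_partitions_card in auto)
  then have "Const (1/2) * (\<Sum>i=1..n - 1. tderiv i (tderiv (n - i) (schur lam))) =
      Const (1/2) * (\<Sum>i=1..n - 1. \<Sum>mu\<in>?M. Const (?q i mu) * schur mu)"
    by (intro arg_cong2[of _ _ _ _ "(*)"] sum.cong refl)
  also have "\<dots> = (\<Sum>mu\<in>?M. Const (1/2 * (\<Sum>i=1..n - 1. ?q i mu)) * schur mu)"
    by (rule Const_half_sum)
  finally have 2: "Const (1/2) * (\<Sum>i=1..n - 1. tderiv i (tderiv (n - i) (schur lam))) = \<dots>" .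
  show ?thesis
    unfolding virasoro_pos_schur[OF n lam] 1 2 path_coef_def Const_simps(3) distrib_right sum.distrib
    by (rule add.commute)
qed

theorem theorem5p1:
  fixes n :: nat and lam :: "nat \<Rightarrow> nat"
  assumes "n \<ge> 1" and "is_partition lam"
  shows "virasoro (- int n) (schur lam :: 'a::field_char_0 tpoly) =
           (\<Sum>mu | border_strip n mu lam. Const (dcoef n lam mu) * schur mu) \<and>
         virasoro (int n) (schur lam :: 'a tpoly) =
           (\<Sum>mu | border_strip n lam mu. Const (dcoef n mu lam) * schur mu)"
proof
  let ?N = "card (diagram lam)"
  show "virasoro (- int n) (schur lam :: 'a tpoly) =
      (\<Sum>mu | border_strip n mu lam. Const (dcoef n lam mu) * schur mu)"
    unfolding virasoro_neg_schur_paths[OF assms]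
  proof (rule sum.mono_neutral_cong_right)
    show "finite {mu. is_partition mu \<and> card (diagram mu) = ?N + n}" by (rule finite_partitions_card)
    show "{mu. border_strip n mu lam} \<subseteq> {mu. is_partition mu \<and> card (diagram mu) = ?N + n}"
      by (auto dest: border_strip_card border_strip_partitions)
    show "\<forall>mu\<in>{mu. is_partition mu \<and> card (diagram mu) = ?N + n} - {mu. border_strip n mu lam}.
        Const (path_coef ?N n lam mu) * schur mu = (0 :: 'a tpoly)"
      by (auto simp: path_coef_zero[OF assms(2) _ assms(1)] Const_simps)
    show "Const (path_coef ?N n lam mu) * schur mu = (Const (dcoef n lam mu) * schur mu :: 'a tpoly)"
      if "mu \<in> {mu. border_strip n mu lam}" for mu
      using that dcoef_eq_path_coef[of n mu lam ?N, where 'a = 'a] by simp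
  qed
  show "virasoro (int n) (schur lam :: 'a tpoly) =
      (\<Sum>mu | border_strip n lam mu. Const (dcoef n mu lam) * schur mu)"
    unfolding virasoro_pos_schur_paths[OF assms]
  proof (rule sum.mono_neutral_cong_right)
    show "finite {mu. is_partition mu \<and> card (diagram mu) = ?N - n}" by (rule finite_partitions_card)
    show "{mu. border_strip n lam mu} \<subseteq> {mu. is_partition mu \<and> card (diagram mu) = ?N - n}"
      by (auto dest: border_strip_card border_strip_partitions)
    show "\<forall>mu\<in>{mu. is_partition mu \<and> card (diagram mu) = ?N - n} - {mu. border_strip n lam mu}.
        Const (path_coef ?N n mu lam) * schur mu = (0 :: 'a tpoly)"
      by (auto simp: path_coef_zero[OF _ assms(2) assms(1)] Const_simps)
    show "Const (path_coef ?N n mu lam) * schur mu = (Const (dcoef n mu lam) * schur mu :: 'a tpoly)"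
      if "mu \<in> {mu. border_strip n lam mu}" for mu
      using that dcoef_eq_path_coef[of n lam mu ?N, where 'a = 'a] border_strip_card[of n lam mu] by simp
  qed
qed

end
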